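(* Let $G$ be a $5$-regular graph that has no $\{4,1\}$-factor, and which is vertex-minimal with this property (every $5$-regular graph with fewer vertices than $G$ has a $\{4,1\}$-factor). Then: (a) $G$ does not contain a copy of $K_4$. (b) $G$ has no parallel non-loop edges. (c) No two vertices with loops are adjacent. (d) $G$ contains at least $5$ loops. (e) There do not exist vertices $u_1,u_2,u_3,v_1,v_2,v_3\in V(G)$ such that each $u_i$ has a loop and $u_i$ is adjacent to $v_j$ for all $i,j\in\{1,2,3\}$.
   Context: All graphs are finite, undirected pseudographs (multiple edges and loops allowed; a loop contributes $2$ to the degree). A $\{4,1\}$-factor of a graph is a spanning subgraph in which every vertex has degree $4$ or $1$. *)

theory Defs
  imports Main "HOL-Library.Multiset"
begin

text \<open>
  Each edge is sent to the multiset of its two ends, so that a loop at \<open>v\<close> has ends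
  \<open>{#v, v#}\<close> and distinct edges may have the same ends.
\<close>

record ('v, 'e) pgraph =
  verts :: "'v set"
  edges :: "'e set"
  ends :: "'e \<Rightarrow> 'v multiset"

definition pseudograph :: "('v, 'e) pgraph \<Rightarrow> bool" where
  "pseudograph G \<longleftrightarrow> finite (verts G) \<and> finite (edges G) \<and>
     (\<forall>e\<in>edges G. size (ends G e) = 2 \<and> set_mset (ends G e) \<subseteq> verts G)"

definition degree :: "('v, 'e) pgraph \<Rightarrow> 'v \<Rightarrow> nat" where
  "degree G v = (\<Sum>e\<in>edges G. count (ends G e) v)"

definition regular :: "nat \<Rightarrow> ('v, 'e) pgraph \<Rightarrow> bool" where
  "regular k G \<longleftrightarrow> (\<forall>v\<in>verts G. degree G v = k)"

definition subgraph :: "('v, 'e) pgraph \<Rightarrow> ('v, 'e) pgraph \<Rightarrow> bool" where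
  "subgraph H G \<longleftrightarrow> pseudograph H \<and> verts H \<subseteq> verts G \<and> edges H \<subseteq> edges G \<and>
     (\<forall>e\<in>edges H. ends H e = ends G e)"

definition spanning_subgraph :: "('v, 'e) pgraph \<Rightarrow> ('v, 'e) pgraph \<Rightarrow> bool" where
  "spanning_subgraph H G \<longleftrightarrow> subgraph H G \<and> verts H = verts G"

definition is_factor :: "nat set \<Rightarrow> ('v, 'e) pgraph \<Rightarrow> ('v, 'e) pgraph \<Rightarrow> bool" where
  "is_factor D H G \<longleftrightarrow> spanning_subgraph H G \<and> (\<forall>v\<in>verts H. degree H v \<in> D)"

definition has_factor :: "nat set \<Rightarrow> ('v, 'e) pgraph \<Rightarrow> bool" where
  "has_factor D G \<longleftrightarrow> (\<exists>H. is_factor D H G)"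

definition adjacent :: "('v, 'e) pgraph \<Rightarrow> 'v \<Rightarrow> 'v \<Rightarrow> bool" where
  "adjacent G u v \<longleftrightarrow> (\<exists>e\<in>edges G. ends G e = {#u, v#})"

definition loops :: "('v, 'e) pgraph \<Rightarrow> 'e set" where
  "loops G = {e \<in> edges G. \<exists>v. ends G e = {#v, v#}}"

definition has_loop :: "('v, 'e) pgraph \<Rightarrow> 'v \<Rightarrow> bool" where
  "has_loop G v \<longleftrightarrow> (\<exists>e\<in>edges G. ends G e = {#v, v#})"

definition complete_graph :: "nat \<Rightarrow> ('v, 'e) pgraph \<Rightarrow> bool" where
  "complete_graph n K \<longleftrightarrow> pseudograph K \<and> card (verts K) = n \<and> loops K = {} \<and>
     (\<forall>u\<in>verts K. \<forall>v\<in>verts K. u \<noteq> v \<longrightarrow> (\<exists>!e. e \<in> edges K \<and> ends K e = {#u, v#}))"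

definition contains_complete :: "nat \<Rightarrow> ('v, 'e) pgraph \<Rightarrow> bool" where
  "contains_complete n G \<longleftrightarrow> (\<exists>K. subgraph K G \<and> complete_graph n K)"

text \<open>
  The competitors in the minimality condition have natural numbers as vertices and edges;
  every finite pseudograph is isomorphic to one of this kind.
\<close>

definition minimal_without_factor :: "nat \<Rightarrow> nat set \<Rightarrow> ('v, 'e) pgraph \<Rightarrow> bool" where
  "minimal_without_factor k D G \<longleftrightarrow>
     pseudograph G \<and> regular k G \<and> \<not> has_factor D G \<and>
     (\<forall>H :: (nat, nat) pgraph.
        pseudograph H \<and> regular k H \<and> card (verts H) < card (verts G) \<longrightarrow> has_factor D H)"

end

theory Submission
  imports Defs "HOL-Library.Disjoint_Sets"
begin

text \<open>
  A \<open>{4, 1}\<close>-factor is a red-blue colouring of the edges with four edge ends of one colour and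
  one of the other at every vertex; exchanging the colours preserves this. For (a), (b), (c) and
  (e), remove the forbidden configuration and splice its dangling edge ends in pairs. A colouring
  of the smaller graph forces the two ends of each spliced pair to have the same colour, and
  splicing ends at vertices \<open>a\<close> and \<open>b\<close> therefore prescribes equal red degrees at \<open>a\<close> and \<open>b\<close>,
  which the configuration can always complete.

  For (d), \<open>G\<close> has no perfect matching, so by Tutte's theorem some \<open>S\<close> leaves at least
  \<open>|S| + 2\<close> odd sets without edges between them, which send at most \<open>5 |S|\<close> edges to \<open>S\<close>. An odd
  set \<open>C\<close> with one or three leaving edges is a single vertex: otherwise each side of the
  cut is completed to smaller 5-regular graphs by one new vertex, either carrying a loop and
  absorbing the three edges, or carrying two loops and absorbing one edge while the other two are
  joined to each other. The colour patterns on the cut obtained in this way on the two sides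
  always have a common member. Hence twice the number of loops at \<open>C\<close> plus the number of edges
  leaving \<open>C\<close> is at least 5, and summation over the odd sets gives five loops.
\<close>

subsection \<open>Splicing\<close>

text \<open>A graph is represented by the multiset \<open>M\<close> of its edges, each edge being
  the multiset of its two ends. Then \<open>\<Sum>\<^sub># M\<close> contains each vertex as often
  as its degree, and degree conditions become equations of multisets.\<close>

definition pairs :: "'v multiset multiset \<Rightarrow> bool" where
  "pairs M \<longleftrightarrow> (\<forall>e\<in>#M. size e = 2)"

lemma size_sum_pairs: "pairs M \<Longrightarrow> size (\<Sum>\<^sub># M) = 2 * size M"
  by (induction M) (auto simp: pairs_def)

lemma subseteq_add_msetE:
  assumes "R \<subseteq># add_mset e K"
  obtains b R' where "R' \<subseteq># K" "R = (if b then {#e#} else {#}) + R'"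
proof (cases "R \<subseteq># K")
  case True
  then show ?thesis using that[of R False] by simp
next
  case False
  then have "e \<in># R"
    using assms by (metis diff_single_trivial subset_eq_diff_conv add_mset_add_single)
  then obtain R' where R': "R = add_mset e R'"
    by (metis insert_DiffM)
  then show ?thesis
    using that[of R' True] assms by simp
qed

lemma pair_mset:
  assumes "size e = 2" "a \<in># e"
  obtains x where "e = {#a, x#}"
proof -
  obtain f where f: "e = add_mset a f"
    using assms(2) by (metis insert_DiffM)
  then have "size f = 1"
    using assms(1) by simp
  then show ?thesis
    using f that by (metis size_1_singleton_mset)
qed

text \<open>An edge between \<open>a\<close> and \<open>b\<close> is deleted if the edge found at
  \<open>a\<close> is one; otherwise edges \<open>{#a, x#}\<close> and \<open>{#b, y#}\<close> are
  replaced by \<open>{#x, y#}\<close>. A red class \<open>R'\<close> lifts back by giving both old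
  edges the colour of the new one, so the ends at \<open>a\<close> and \<open>b\<close> are both red
  or both blue.\<close>

lemma splice:
  assumes "pairs M" "{#a, b#} \<subseteq># \<Sum>\<^sub># M"
  obtains M' where "pairs M'" "\<Sum>\<^sub># M = \<Sum>\<^sub># M' + {#a, b#}"
    "\<And>R'. R' \<subseteq># M' \<Longrightarrow> \<exists>R. R \<subseteq># M \<and> (\<Sum>\<^sub># R = \<Sum>\<^sub># R' \<or> \<Sum>\<^sub># R = \<Sum>\<^sub># R' + {#a, b#})"
proof -
  have "a \<in># \<Sum>\<^sub># M"
    using assms(2) by (meson insert_subset_eq_iff mset_subset_eq_insertD)
  then obtain e where e: "e \<in># M" "a \<in># e"
    by (auto simp: in_Union_mset_iff)
  obtain x where x: "e = {#a, x#}"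
    using pair_mset e assms(1) unfolding pairs_def by metis
  obtain N where N: "M = add_mset {#a, x#} N"
    using e x by (metis insert_DiffM)
  have pN: "pairs N"
    using assms(1) N by (simp add: pairs_def)
  show ?thesis
  proof (cases "x = b")
    case True
    have "R' \<subseteq># M" if "R' \<subseteq># N" for R'
      using that N by (simp add: subset_mset.order_trans[OF that])
    then show ?thesis
      using that[OF pN] N True by (auto simp: union_commute)
  next
    case False
    have "b \<in># \<Sum>\<^sub># N"
      using assms(2) False by (auto simp: N dest!: mset_subset_eqD[where x = b] mset_subset_eq_insertD)
    then obtain f where f: "f \<in># N" "b \<in># f"
      by (auto simp: in_Union_mset_iff)
    obtain y where y: "f = {#b, y#}"
      using pair_mset f pN unfolding pairs_def by metis
    obtain K where K: "N = add_mset {#b, y#} K"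
      using f y by (metis insert_DiffM)
    show ?thesis
    proof (rule that[of "add_mset {#x, y#} K"])
      show "pairs (add_mset {#x, y#} K)"
        using pN K by (simp add: pairs_def)
      show "\<Sum>\<^sub># M = \<Sum>\<^sub># (add_mset {#x, y#} K) + {#a, b#}"
        by (simp add: N K)
      fix R'
      assume "R' \<subseteq># add_mset {#x, y#} K"
      then obtain c R where R: "R \<subseteq># K" "R' = (if c then {#{#x, y#}#} else {#}) + R"
        by (rule subseteq_add_msetE)
      have "(if c then {#{#a, x#}, {#b, y#}#} else {#}) + R \<subseteq># M"
        using R(1) unfolding N K
        by (auto intro: subset_mset.order_trans[OF R(1)])
      moreover have "\<Sum>\<^sub># ((if c then {#{#a, x#}, {#b, y#}#} else {#}) + R) =
          \<Sum>\<^sub># R' + (if c then {#a, b#} else {#})"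
        by (simp add: R(2))
      ultimately show "\<exists>R. R \<subseteq># M \<and> (\<Sum>\<^sub># R = \<Sum>\<^sub># R' \<or> \<Sum>\<^sub># R = \<Sum>\<^sub># R' + {#a, b#})"
        by (intro exI conjI) (auto split: if_splits)
    qed
  qed
qed

text \<open>Here \<open>j\<close> is the number of the \<open>k\<close> spliced pairs of ends that
  become red.\<close>

lemma splice_repeat:
  assumes "pairs M" "repeat_mset k {#a, b#} \<subseteq># \<Sum>\<^sub># M"
  obtains M' where "pairs M'" "\<Sum>\<^sub># M = \<Sum>\<^sub># M' + repeat_mset k {#a, b#}"
    "\<And>R'. R' \<subseteq># M' \<Longrightarrow>
      \<exists>R j. R \<subseteq># M \<and> j \<le> k \<and> \<Sum>\<^sub># R = \<Sum>\<^sub># R' + repeat_mset j {#a, b#}"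
  using assms
proof (induction k arbitrary: M thesis)
  case 0
  then show ?case
    by (metis add.right_neutral le0 repeat_mset_0)
next
  case (Suc k)
  have "{#a, b#} \<subseteq># \<Sum>\<^sub># M"
    using Suc.prems(3)
    by (metis mset_subset_eq_add_left repeat_mset_Suc subset_mset.order_trans)
  then obtain N where N: "pairs N" "\<Sum>\<^sub># M = \<Sum>\<^sub># N + {#a, b#}"
    "\<And>R'. R' \<subseteq># N \<Longrightarrow> \<exists>R. R \<subseteq># M \<and> (\<Sum>\<^sub># R = \<Sum>\<^sub># R' \<or> \<Sum>\<^sub># R = \<Sum>\<^sub># R' + {#a, b#})"
    using splice Suc.prems(2) by metis
  have "repeat_mset k {#a, b#} \<subseteq># \<Sum>\<^sub># N"
    using Suc.prems(3) N(2) by simp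
  then obtain M' where M': "pairs M'" "\<Sum>\<^sub># N = \<Sum>\<^sub># M' + repeat_mset k {#a, b#}"
    "\<And>R'. R' \<subseteq># M' \<Longrightarrow>
      \<exists>R j. R \<subseteq># N \<and> j \<le> k \<and> \<Sum>\<^sub># R = \<Sum>\<^sub># R' + repeat_mset j {#a, b#}"
    using Suc.IH N(1) by metis
  show ?case
  proof (rule Suc.prems(1)[OF M'(1)])
    show "\<Sum>\<^sub># M = \<Sum>\<^sub># M' + repeat_mset (Suc k) {#a, b#}"
      using N(2) M'(2) by simp
    fix R'
    assume "R' \<subseteq># M'"
    then obtain R j where R: "R \<subseteq># N" "j \<le> k" "\<Sum>\<^sub># R = \<Sum>\<^sub># R' + repeat_mset j {#a, b#}"
      using M'(3) by blast
    obtain Q where Q: "Q \<subseteq># M" "\<Sum>\<^sub># Q = \<Sum>\<^sub># R \<or> \<Sum>\<^sub># Q = \<Sum>\<^sub># R + {#a, b#}"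
      using N(3)[OF R(1)] by blast
    from Q(2) have "\<Sum>\<^sub># Q = \<Sum>\<^sub># R' + repeat_mset j {#a, b#} \<or>
        \<Sum>\<^sub># Q = \<Sum>\<^sub># R' + repeat_mset (Suc j) {#a, b#}"
      using R(3) by auto
    then show "\<exists>R j. R \<subseteq># M \<and> j \<le> Suc k \<and> \<Sum>\<^sub># R = \<Sum>\<^sub># R' + repeat_mset j {#a, b#}"
      using Q(1) R(2) by (meson Suc_le_mono le_SucI)
  qed
qed

subsection \<open>Multisets of edges\<close>

definition edge_mset :: "('v, 'e) pgraph \<Rightarrow> 'v multiset multiset" where
  "edge_mset G = image_mset (ends G) (mset_set (edges G))"

text \<open>\<open>R\<close> is the red class, that is, the edge set of a factor with its edge names
  forgotten.\<close>

definition colourable :: "nat set \<Rightarrow> 'v set \<Rightarrow> 'v multiset multiset \<Rightarrow> bool" where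
  "colourable D V M \<longleftrightarrow> (\<exists>R. R \<subseteq># M \<and> (\<forall>v\<in>V. count (\<Sum>\<^sub># R) v \<in> D))"

lemma degree_eq_count: "degree G v = count (\<Sum>\<^sub># (edge_mset G)) v"
proof -
  have "count (\<Sum>\<^sub># (image_mset f A)) v = (\<Sum>e\<in>#A. count (f e) v)" for f :: "'b \<Rightarrow> 'a multiset" and A
    by (induction A) auto
  then show ?thesis
    unfolding degree_def edge_mset_def by (simp add: sum_unfold_sum_mset)
qed

lemma pairs_edge_mset: "pseudograph G \<Longrightarrow> pairs (edge_mset G)"
  unfolding pseudograph_def pairs_def edge_mset_def by simp

lemma subseteq_image_msetE:
  assumes "R \<subseteq># image_mset f A"
  obtains B where "B \<subseteq># A" "R = image_mset f B"
proof -
  obtain Q where "image_mset f A = R + Q"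
    using assms by (metis subset_mset.add_diff_inverse)
  then show ?thesis
    using that by (metis image_mset_eq_plusD mset_subset_eq_add_left)
qed

lemma has_factor_iff:
  assumes "pseudograph G"
  shows "has_factor D G \<longleftrightarrow> colourable D (verts G) (edge_mset G)"
proof
  assume "has_factor D G"
  then obtain H where H: "spanning_subgraph H G" "\<forall>v\<in>verts H. degree H v \<in> D"
    unfolding has_factor_def is_factor_def by blast
  then have sub: "verts H = verts G" "edges H \<subseteq> edges G" "\<forall>e\<in>edges H. ends H e = ends G e"
    "finite (edges H)"
    unfolding spanning_subgraph_def subgraph_def pseudograph_def by auto
  have "edge_mset H = image_mset (ends G) (mset_set (edges H))"
    unfolding edge_mset_def using sub by (intro image_mset_cong) simp
  moreover have "mset_set (edges H) \<subseteq># mset_set (edges G)"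
    using sub assms by (simp add: pseudograph_def subset_imp_msubset_mset_set)
  ultimately have "edge_mset H \<subseteq># edge_mset G"
    unfolding edge_mset_def by (simp add: image_mset_subseteq_mono)
  then show "colourable D (verts G) (edge_mset G)"
    unfolding colourable_def using H(2) sub(1) by (auto simp: degree_eq_count)
next
  assume "colourable D (verts G) (edge_mset G)"
  then obtain R where R: "R \<subseteq># edge_mset G" "\<forall>v\<in>verts G. count (\<Sum>\<^sub># R) v \<in> D"
    unfolding colourable_def by blast
  obtain B where B: "B \<subseteq># mset_set (edges G)" "R = image_mset (ends G) B"
    using R(1) subseteq_image_msetE unfolding edge_mset_def by metis
  have fin: "finite (edges G)"
    using assms by (simp add: pseudograph_def)
  \<comment> \<open>\<open>B\<close> lies below a multiset without repetitions, so it is the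
    multiset of a set of edges and defines a subgraph.\<close>
  have B_eq: "mset_set (set_mset B) = B"
  proof (rule multiset_eqI)
    fix e
    have "count B e \<le> 1"
      using mset_subset_eq_count[OF B(1), of e] by (auto simp: count_mset_set' split: if_splits)
    then show "count (mset_set (set_mset B)) e = count B e"
      by (cases "count B e") (auto simp: count_mset_set' not_in_iff simp flip: count_greater_zero_iff)
  qed
  define H where "H = G\<lparr>edges := set_mset B\<rparr>"
  have "edge_mset H = R"
    using B(2) B_eq by (simp add: H_def edge_mset_def)
  moreover have "set_mset B \<subseteq> edges G"
    using set_mset_mono[OF B(1)] fin by simp
  ultimately have "is_factor D H G"
    using assms R(2) unfolding is_factor_def spanning_subgraph_def subgraph_def degree_eq_count
    by (auto simp: pseudograph_def H_def)
  then show "has_factor D G"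
    unfolding has_factor_def by blast
qed

lemma regular_sum_edge_mset:
  assumes "pseudograph G" "regular k G"
  shows "\<Sum>\<^sub># (edge_mset G) = repeat_mset k (mset_set (verts G))"
proof (rule multiset_eqI)
  fix v
  have "count (\<Sum>\<^sub># (edge_mset G)) v = 0" if "v \<notin> verts G"
  proof -
    have "v \<notin># \<Sum>\<^sub># (edge_mset G)"
      using assms(1) that unfolding edge_mset_def pseudograph_def by auto
    then show ?thesis
      by (metis not_in_iff)
  qed
  then show "count (\<Sum>\<^sub># (edge_mset G)) v = count (repeat_mset k (mset_set (verts G))) v"
    using assms by (auto simp: regular_def degree_eq_count count_mset_set' pseudograph_def)
qed

lemma count_image_mset_inj_on:
  assumes "inj_on f V" "set_mset S \<subseteq> V" "v \<in> V"
  shows "count (image_mset f S) (f v) = count S v"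
  using assms(2) by (induction S) (use assms(1,3) in \<open>auto dest: inj_onD\<close>)

lemma image_mset_Union_mset: "image_mset f (\<Sum>\<^sub># M) = \<Sum>\<^sub># (image_mset (image_mset f) M)"
  by (induction M) auto

lemma set_mset_repeat_mset_set:
  assumes "finite V"
  shows "set_mset (repeat_mset k (mset_set V)) \<subseteq> V"
  using assms by (cases "k = 0") (auto simp: count_mset_set' simp flip: count_greater_zero_iff split: if_splits)

text \<open>The competitors in the minimality condition have natural numbers as vertices and edges.
  An injection \<open>f\<close> renames the vertices, and the positions in a list \<open>xs\<close>
  of the edges serve as edge names; since \<open>f\<close> is injective on \<open>V\<close>, degrees
  are kept and the red class can be pulled back.\<close>

lemma minimal_colourable:
  fixes G :: "('v, 'e) pgraph" and V :: "'w set"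
  assumes min: "minimal_without_factor k D G"
    and V: "finite V" "card V < card (verts G)"
    and M: "pairs M" "\<Sum>\<^sub># M = repeat_mset k (mset_set V)"
  shows "colourable D V M"
proof -
  obtain f :: "'w \<Rightarrow> nat" where f: "inj_on f V"
    using V(1) finite_imp_inj_to_nat_seg by metis
  obtain xs where xs: "mset xs = M"
    using ex_mset by blast
  define H where
    "H = \<lparr>verts = f ` V, edges = {..<length xs}, ends = \<lambda>i. image_mset f (xs ! i)\<rparr>"
  have nth_xs: "image_mset ((!) xs) (mset_set {..<length xs}) = mset xs"
    by (metis lessThan_atLeast0 map_nth mset_map mset_upt)
  then have H_mset: "edge_mset H = image_mset (image_mset f) M"
    unfolding edge_mset_def H_def xs[symmetric]
    by (simp add: image_mset.compositionality comp_def flip: nth_xs)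
  have supp: "set_mset (\<Sum>\<^sub># M) \<subseteq> V"
    unfolding M(2) by (rule set_mset_repeat_mset_set[OF V(1)])
  have "size (ends H e) = 2 \<and> set_mset (ends H e) \<subseteq> verts H" if "e \<in> edges H" for e
  proof -
    have "xs ! e \<in># M"
      using that xs by (auto simp: H_def)
    then show ?thesis
      using M(1) supp by (auto simp: H_def pairs_def)
  qed
  then have psH: "pseudograph H"
    using V(1) by (auto simp: pseudograph_def H_def)
  have "degree H w = k" if "w \<in> verts H" for w
  proof -
    from that obtain v where v: "v \<in> V" "w = f v"
      by (auto simp: H_def)
    then show ?thesis
      using count_image_mset_inj_on[OF f supp v(1)] V(1) M(2)
      by (simp add: degree_eq_count H_mset flip: image_mset_Union_mset)
  qed
  then have "regular k H"
    by (simp add: regular_def)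
  moreover have "card (verts H) < card (verts G)"
    using V f by (simp add: H_def card_image)
  ultimately have "colourable D (f ` V) (edge_mset H)"
    using min psH has_factor_iff[OF psH] unfolding minimal_without_factor_def
    by (auto simp: H_def)
  then obtain R where R: "R \<subseteq># image_mset (image_mset f) M" "\<forall>v\<in>V. count (\<Sum>\<^sub># R) (f v) \<in> D"
    by (auto simp: colourable_def H_mset)
  obtain Q where Q: "Q \<subseteq># M" "R = image_mset (image_mset f) Q"
    using R(1) by (rule subseteq_image_msetE)
  have "set_mset (\<Sum>\<^sub># Q) \<subseteq> V"
    using supp set_mset_mono[OF Q(1)] by auto
  then have "\<forall>v\<in>V. count (\<Sum>\<^sub># Q) v \<in> D"
    using R(2) count_image_mset_inj_on[OF f] Q(2) by (metis image_mset_Union_mset)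
  then show ?thesis
    using Q(1) by (auto simp: colourable_def)
qed

subsection \<open>Gadget reductions\<close>

text \<open>The smaller graphs have the same vertex type as the given one, so a vertex added to a
  piece of the graph is always named by a vertex outside that piece.\<close>

locale minimal_multigraph =
  fixes V :: "'v set" and M :: "'v multiset multiset"
  assumes finite_V: "finite V"
    and pairs_M: "pairs M"
    and sum_M: "\<Sum>\<^sub># M = repeat_mset 5 (mset_set V)"
    and not_colourable: "\<not> colourable {4, 1} V M"
    and smaller_colourable: "\<And>V' M'. finite V' \<Longrightarrow> card V' < card V \<Longrightarrow> pairs M' \<Longrightarrow>
      \<Sum>\<^sub># M' = repeat_mset 5 (mset_set V') \<Longrightarrow> colourable {4, 1} V' (M' :: 'v multiset multiset)"

lemma minimal_multigraphI:
  assumes "minimal_without_factor 5 {4, 1} G"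
  shows "minimal_multigraph (verts G) (edge_mset G)"
proof -
  have G: "pseudograph G" "regular 5 G" "\<not> has_factor {4, 1} G"
    using assms by (auto simp: minimal_without_factor_def)
  show ?thesis
  proof
    show "finite (verts G)"
      using G(1) by (simp add: pseudograph_def)
    show "\<not> colourable {4, 1} (verts G) (edge_mset G)"
      using G(3) has_factor_iff[OF G(1)] by simp
  qed (fact pairs_edge_mset[OF G(1)] regular_sum_edge_mset[OF G(1,2)] minimal_colourable[OF assms])+
qed

context minimal_multigraph
begin

lemma edge_ends:
  assumes "e \<in># M"
  shows "set_mset e \<subseteq> V"
proof -
  have "set_mset (\<Sum>\<^sub># M) \<subseteq> V"
    unfolding sum_M by (rule set_mset_repeat_mset_set[OF finite_V])
  then show ?thesis
    using assms by auto
qed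

text \<open>
  The edges in \<open>A\<close> and the vertices in \<open>W\<close> are removed, and the remaining edge ends at
  \<open>W\<close> are spliced: \<open>k\<close> times one at \<open>a\<close> with one at \<open>b\<close>, and \<open>l\<close> times one at \<open>c\<close> with one
  at \<open>d\<close>. A colouring of the smaller graph prescribes red degrees \<open>i\<close> at \<open>a\<close> and \<open>b\<close>,
  and \<open>j\<close> at \<open>c\<close> and \<open>d\<close>.
\<close>

lemma reduction:
  assumes A: "A \<subseteq># M" and W: "W \<subseteq> V" "W \<noteq> {}"
    and sum_A: "repeat_mset 5 (mset_set W) =
      \<Sum>\<^sub># A + repeat_mset k {#a, b#} + repeat_mset l {#c, d#}"
    and extend: "\<And>i j. i \<le> k \<Longrightarrow> j \<le> l \<Longrightarrow> \<exists>Q. Q \<subseteq># A \<and>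
      (\<forall>w\<in>W. count (\<Sum>\<^sub># Q + repeat_mset i {#a, b#} + repeat_mset j {#c, d#}) w \<in> {4, 1})"
  shows False
proof -
  obtain N where N: "M = A + N"
    using A by (metis subset_mset.add_diff_inverse)
  have fin: "finite W" "finite (V - W)"
    using W(1) finite_V finite_subset by auto
  have "mset_set V = mset_set W + mset_set (V - W)"
    using fin W(1) mset_set_Union[of W "V - W"] by (simp add: Un_absorb1)
  \<comment> \<open>Apart from five ends at each vertex outside \<open>W\<close>, the remaining
    edges have exactly the ends at \<open>W\<close> that are to be spliced away.\<close>
  then have sum_N: "\<Sum>\<^sub># N = repeat_mset 5 (mset_set (V - W)) + repeat_mset l {#c, d#} + repeat_mset k {#a, b#}"
    using sum_M by (simp add: N sum_A)
  have "pairs N"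
    using pairs_M by (simp add: pairs_def N)
  from splice_repeat[OF this, of k a b] obtain L where L: "pairs L"
    "\<Sum>\<^sub># N = \<Sum>\<^sub># L + repeat_mset k {#a, b#}"
    "\<And>R'. R' \<subseteq># L \<Longrightarrow> \<exists>R j. R \<subseteq># N \<and> j \<le> k \<and> \<Sum>\<^sub># R = \<Sum>\<^sub># R' + repeat_mset j {#a, b#}"
    using sum_N by (metis mset_subset_eq_add_right)
  have sum_L: "\<Sum>\<^sub># L = repeat_mset 5 (mset_set (V - W)) + repeat_mset l {#c, d#}"
    using sum_N L(2) by (metis add_right_cancel)
  from splice_repeat[OF L(1), of l c d] obtain K where K: "pairs K"
    "\<Sum>\<^sub># L = \<Sum>\<^sub># K + repeat_mset l {#c, d#}"
    "\<And>R'. R' \<subseteq># K \<Longrightarrow> \<exists>R j. R \<subseteq># L \<and> j \<le> l \<and> \<Sum>\<^sub># R = \<Sum>\<^sub># R' + repeat_mset j {#c, d#}"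
    using sum_L by (metis mset_subset_eq_add_right)
  have sum_K: "\<Sum>\<^sub># K = repeat_mset 5 (mset_set (V - W))"
    using sum_L K(2) by (metis add_right_cancel)
  have "card (V - W) < card V"
    using W finite_V by (intro psubset_card_mono) auto
  then have "colourable {4, 1} (V - W) K"
    using smaller_colourable K(1) sum_K fin by simp
  then obtain R' where R': "R' \<subseteq># K" "\<forall>v\<in>V - W. count (\<Sum>\<^sub># R') v \<in> {4, 1}"
    by (auto simp: colourable_def)
  obtain R'' j where R'': "R'' \<subseteq># L" "j \<le> l" "\<Sum>\<^sub># R'' = \<Sum>\<^sub># R' + repeat_mset j {#c, d#}"
    using K(3)[OF R'(1)] by blast
  obtain R i where R: "R \<subseteq># N" "i \<le> k" "\<Sum>\<^sub># R = \<Sum>\<^sub># R'' + repeat_mset i {#a, b#}"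
    using L(3)[OF R''(1)] by blast
  obtain Q where Q: "Q \<subseteq># A"
    "\<forall>w\<in>W. count (\<Sum>\<^sub># Q + repeat_mset i {#a, b#} + repeat_mset j {#c, d#}) w \<in> {4, 1}"
    using extend[OF R(2) R''(2)] by blast
  define E where "E = \<Sum>\<^sub># Q + repeat_mset i {#a, b#} + repeat_mset j {#c, d#}"
  have sum: "\<Sum>\<^sub># (Q + R) = \<Sum>\<^sub># R' + E"
    using R(3) R''(3) by (simp add: E_def)
  have "\<Sum>\<^sub># A = \<Sum>\<^sub># Q + \<Sum>\<^sub># (A - Q)"
    using Q(1) by (metis subset_mset.add_diff_inverse sum_mset.union)
  \<comment> \<open>\<open>E\<close> is contained in the sum of all ends at \<open>W\<close>, so
    adding it leaves the red degrees outside \<open>W\<close> unchanged.\<close>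
  then have "count E v \<le> count (repeat_mset 5 (mset_set W)) v" for v
    unfolding sum_A E_def count_union count_repeat_mset
    using R(2) R''(2) by (intro add_mono mult_right_mono) auto
  then have E_0: "count E v = 0" if "v \<notin> W" for v
    using that by (metis count_mset_set(3) count_repeat_mset le_zero_eq mult_0_right)
  have "\<Sum>\<^sub># K = \<Sum>\<^sub># R' + \<Sum>\<^sub># (K - R')"
    using R'(1) by (metis subset_mset.add_diff_inverse sum_mset.union)
  then have R'_0: "count (\<Sum>\<^sub># R') v = 0" if "v \<in> W" for v
    using that sum_K
    by (metis DiffD2 add_is_0 count_mset_set(3) count_repeat_mset count_union mult_0_right)
  have "count (\<Sum>\<^sub># (Q + R)) v \<in> {4, 1}" if "v \<in> V" for v
  proof (cases "v \<in> W")
    case True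
    then show ?thesis
      using Q(2) R'_0 unfolding sum count_union[of _ E] E_def[symmetric] by simp
  next
    case False
    then show ?thesis
      using R'(2) E_0 that unfolding sum count_union[of _ E] by simp
  qed
  moreover have "Q + R \<subseteq># M"
    using R(1) Q(1) by (simp add: N subset_mset.add_mono)
  ultimately show False
    using not_colourable unfolding colourable_def by blast
qed

end

section \<open>The configurations excluded by splicing\<close>

lemma mset_subseteq_if_distinct:
  assumes "distinct xs" "set xs \<subseteq> set_mset M"
  shows "mset xs \<subseteq># M"
  using assms
  by (metis finite_set_mset mset_set_set mset_set_set_mset_msubset subset_imp_msubset_mset_set
      subset_mset.order_trans)

context minimal_multigraph
begin

text \<open>Three ends remain at each of \<open>u\<close> and \<open>v\<close> and are spliced
  crosswise. With \<open>i\<close> red ends at both, colouring one parallel edge red for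
  \<open>i = 0\<close> or \<open>i = 3\<close>, none for \<open>i = 1\<close> and both for
  \<open>i = 2\<close> gives red degree 1 or 4. The second splice has multiplicity 0, with
  \<open>u\<close>, \<open>u\<close> as placeholders.\<close>

lemma no_parallel:
  assumes "u \<noteq> v" "{#{#u, v#}, {#u, v#}#} \<subseteq># M"
  shows False
proof (rule reduction[OF assms(2), of "{u, v}" 3 u v 0 u u])
  have "{#u, v#} \<in># M"
    using assms(2) by (meson mset_subset_eqD union_single_eq_member)
  then show "{u, v} \<subseteq> V"
    using edge_ends by fastforce
  show "repeat_mset 5 (mset_set {u, v}) =
      \<Sum>\<^sub># {#{#u, v#}, {#u, v#}#} + repeat_mset 3 {#u, v#} + repeat_mset 0 {#u, u#}"
    using assms(1) by (simp add: numeral_eq_Suc)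
  fix i j :: nat
  assume ij: "i \<le> 3" "j \<le> 0"
  define Q where "Q = (if i = 2 then {#{#u, v#}, {#u, v#}#} else if i = 1 then {#} else {#{#u, v#}#})"
  show "\<exists>Q. Q \<subseteq># {#{#u, v#}, {#u, v#}#} \<and>
      (\<forall>w\<in>{u, v}. count (\<Sum>\<^sub># Q + repeat_mset i {#u, v#} + repeat_mset j {#u, u#}) w \<in> {4, 1})"
    using assms(1) ij by (intro exI[of _ Q]) (auto simp: Q_def numeral_eq_Suc le_Suc_eq)
qed simp

text \<open>A loop and the joining edge leave two ends at each vertex. With \<open>i\<close> red
  ends at both, the joining edge is red for \<open>i = 0\<close>, nothing for \<open>i = 1\<close>
  and both loops for \<open>i = 2\<close>.\<close>

lemma no_adjacent_loops:
  assumes "u \<noteq> v" "{#u, u#} \<in># M" "{#v, v#} \<in># M" "{#u, v#} \<in># M"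
  shows False
proof (rule reduction[of "mset [{#u, u#}, {#v, v#}, {#u, v#}]" "{u, v}" 2 u v 0 u u])
  show "mset [{#u, u#}, {#v, v#}, {#u, v#}] \<subseteq># M"
    using assms by (intro mset_subseteq_if_distinct) (auto simp: add_eq_conv_ex)
  show "{u, v} \<subseteq> V"
    using edge_ends assms(4) by fastforce
  show "repeat_mset 5 (mset_set {u, v}) =
      \<Sum>\<^sub># (mset [{#u, u#}, {#v, v#}, {#u, v#}]) + repeat_mset 2 {#u, v#} + repeat_mset 0 {#u, u#}"
    using assms(1) by (simp add: numeral_eq_Suc)
  fix i j :: nat
  assume ij: "i \<le> 2" "j \<le> 0"
  define Q where "Q = (if i = 2 then {#{#u, u#}, {#v, v#}#} else if i = 1 then {#} else {#{#u, v#}#})"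
  show "\<exists>Q. Q \<subseteq># mset [{#u, u#}, {#v, v#}, {#u, v#}] \<and>
      (\<forall>w\<in>{u, v}. count (\<Sum>\<^sub># Q + repeat_mset i {#u, v#} + repeat_mset j {#u, u#}) w \<in> {4, 1})"
    using assms(1) ij by (intro exI[of _ Q]) (auto simp: Q_def numeral_eq_Suc le_Suc_eq)
qed simp

text \<open>Two ends remain at each vertex, spliced between \<open>a\<close> and \<open>b\<close>
  and between \<open>c\<close> and \<open>d\<close>. A vertex with 0, 1 or 2 red ends outside needs
  red degree 1, 0 or 3, or 2 respectively inside the \<open>K_4\<close>.\<close>

lemma no_K4:
  assumes "distinct [a, b, c, d]"
    and "{{#a, b#}, {#a, c#}, {#a, d#}, {#b, c#}, {#b, d#}, {#c, d#}} \<subseteq> set_mset M"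
  shows False
proof -
  define xs where "xs = [{#a, b#}, {#a, c#}, {#a, d#}, {#b, c#}, {#b, d#}, {#c, d#}]"
  have xs: "distinct xs"
    using assms(1) by (auto simp: xs_def add_eq_conv_ex)
  show False
  proof (rule reduction[of "mset xs" "{a, b, c, d}" 2 a b 2 c d])
    show "mset xs \<subseteq># M"
      using assms(2) xs by (intro mset_subseteq_if_distinct) (auto simp: xs_def)
    show "{a, b, c, d} \<subseteq> V"
      using edge_ends[of "{#a, b#}"] edge_ends[of "{#c, d#}"] assms(2) by auto
    show "repeat_mset 5 (mset_set {a, b, c, d}) =
        \<Sum>\<^sub># (mset xs) + repeat_mset 2 {#a, b#} + repeat_mset 2 {#c, d#}"
      using assms(1) by (simp add: xs_def numeral_eq_Suc)
    fix i j :: nat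
    assume ij: "i \<le> 2" "j \<le> 2"
    \<comment> \<open>The red edges form a perfect matching for (0,0), a 4-cycle for (2,2) and a
      path through all four vertices for (0,2) and (2,0). If \<open>i\<close> or \<open>j\<close> is
      1, a vertex with one red end outside takes red degree 0 or 3 inside.\<close>
    define ys where "ys =
      (if i = 1 then
         if j = 1 then [] else if j = 0 then [{#c, d#}]
         else [{#a, c#}, {#a, d#}, {#b, c#}, {#b, d#}, {#a, b#}]
       else if j = 1 then
         if i = 0 then [{#a, b#}]
         else [{#a, c#}, {#a, d#}, {#b, c#}, {#b, d#}, {#c, d#}]
       else if i = j then
         if i = 0 then [{#a, b#}, {#c, d#}] else [{#a, c#}, {#a, d#}, {#b, c#}, {#b, d#}]
       else if i = 0 then [{#a, c#}, {#c, d#}, {#b, d#}]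
       else [{#a, c#}, {#a, b#}, {#b, d#}])"
    have "mset ys \<subseteq># mset xs"
      by (simp add: xs_def ys_def)
    moreover have "\<forall>w\<in>{a, b, c, d}.
        count (\<Sum>\<^sub># (mset ys) + repeat_mset i {#a, b#} + repeat_mset j {#c, d#}) w \<in> {4, 1}"
      using assms(1) ij by (auto simp: ys_def numeral_eq_Suc le_Suc_eq)
    ultimately show "\<exists>Q. Q \<subseteq># mset xs \<and> (\<forall>w\<in>{a, b, c, d}.
        count (\<Sum>\<^sub># Q + repeat_mset i {#a, b#} + repeat_mset j {#c, d#}) w \<in> {4, 1})"
      by blast
  qed simp
qed

text \<open>All five ends at each \<open>u\<close> lie inside the configuration, while each
  \<open>v\<close> has two more. Splicing \<open>v1\<close> with \<open>v2\<close> twice and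
  \<open>v3\<close> with itself once prescribes red degrees \<open>i\<close>, \<open>i\<close> and
  \<open>2 * j\<close>. Each \<open>u\<close> must have one or two red edges to the
  \<open>v\<close>s, and its loop is red exactly when there are two.\<close>

lemma no_looped_K33:
  assumes dist: "distinct [u1, u2, u3, v1, v2, v3]"
    and loops: "{{#u1, u1#}, {#u2, u2#}, {#u3, u3#}} \<subseteq> set_mset M"
    and edges: "{{#u1, v1#}, {#u1, v2#}, {#u1, v3#}, {#u2, v1#}, {#u2, v2#}, {#u2, v3#},
      {#u3, v1#}, {#u3, v2#}, {#u3, v3#}} \<subseteq> set_mset M"
  shows False
proof -
  define xs where "xs = [{#u1, u1#}, {#u2, u2#}, {#u3, u3#}, {#u1, v1#}, {#u1, v2#}, {#u1, v3#},
    {#u2, v1#}, {#u2, v2#}, {#u2, v3#}, {#u3, v1#}, {#u3, v2#}, {#u3, v3#}]"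
  have xs: "distinct xs"
    using dist by (auto simp: xs_def add_eq_conv_ex)
  let ?W = "{u1, u2, u3, v1, v2, v3}"
  show False
  proof (rule reduction[of "mset xs" ?W 2 v1 v2 1 v3 v3])
    show "mset xs \<subseteq># M"
      using loops edges xs by (intro mset_subseteq_if_distinct) (auto simp: xs_def)
    show "?W \<subseteq> V"
      using edges edge_ends[of "{#u1, v1#}"] edge_ends[of "{#u2, v2#}"] edge_ends[of "{#u3, v3#}"]
      by auto
    show "repeat_mset 5 (mset_set ?W) =
        \<Sum>\<^sub># (mset xs) + repeat_mset 2 {#v1, v2#} + repeat_mset 1 {#v3, v3#}"
      using dist by (simp add: xs_def numeral_eq_Suc)
    fix i j :: nat
    assume ij: "i \<le> 2" "j \<le> 1"
    \<comment> \<open>The red edges other than loops form a perfect matching for (0,0) and a 6-cycle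
      for (2,1). For \<open>i = 1\<close> the vertex \<open>v1\<close> takes three of them and
      \<open>v2\<close> none.\<close>
    define ys where "ys =
      (if i = 0 then
         if j = 0 then [{#u1, v1#}, {#u2, v2#}, {#u3, v3#}]
         else [{#u1, v1#}, {#u1, v2#}, {#u2, v3#}, {#u3, v3#}, {#u1, u1#}]
       else if i = 1 then
         if j = 0 then [{#u1, v1#}, {#u2, v1#}, {#u3, v1#}, {#u1, v3#}, {#u1, u1#}]
         else [{#u1, v1#}, {#u2, v1#}, {#u3, v1#}, {#u1, v3#}, {#u2, v3#}, {#u1, u1#}, {#u2, u2#}]
       else
         if j = 0 then [{#u2, v1#}, {#u3, v1#}, {#u2, v2#}, {#u3, v2#}, {#u1, v3#},
           {#u2, u2#}, {#u3, u3#}]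
         else [{#u1, v2#}, {#u1, v3#}, {#u2, v1#}, {#u2, v3#}, {#u3, v1#}, {#u3, v2#},
           {#u1, u1#}, {#u2, u2#}, {#u3, u3#}])"
    have "mset ys \<subseteq># mset xs"
      by (simp add: xs_def ys_def)
    moreover have "\<forall>w\<in>?W.
        count (\<Sum>\<^sub># (mset ys) + repeat_mset i {#v1, v2#} + repeat_mset j {#v3, v3#}) w \<in> {4, 1}"
      using dist ij by (auto simp: ys_def numeral_eq_Suc le_Suc_eq)
    ultimately show "\<exists>Q. Q \<subseteq># mset xs \<and> (\<forall>w\<in>?W.
        count (\<Sum>\<^sub># Q + repeat_mset i {#v1, v2#} + repeat_mset j {#v3, v3#}) w \<in> {4, 1})"
      by blast
  qed simp
qed

end

subsection \<open>Perfect matchings\<close>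

text \<open>Induction on \<open>card I\<close>. If a nonempty proper subset \<open>J\<close> has
  exactly \<open>card J\<close> neighbours, \<open>J\<close> and its complement are matched
  separately; otherwise an arbitrary \<open>i\<close> is matched to an arbitrary neighbour.\<close>

lemma marriage:
  assumes "finite I" "\<And>i. i \<in> I \<Longrightarrow> finite (N i)"
    and "\<And>J. J \<subseteq> I \<Longrightarrow> card J \<le> card (\<Union>(N ` J))"
  shows "\<exists>f. inj_on f I \<and> (\<forall>i\<in>I. f i \<in> N i)"
  using assms
proof (induction "card I" arbitrary: I N rule: less_induct)
  case less
  note fin = less.prems(1,2) and hall = less.prems(3)
  have fin_N: "finite (\<Union>(N ` J))" if "J \<subseteq> I" for J
    using that fin by (meson finite_UN_I finite_subset subset_iff)
  show ?case
  proof (cases "\<exists>J. J \<subset> I \<and> J \<noteq> {} \<and> card (\<Union>(N ` J)) = card J")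
    case True
    then obtain J where J: "J \<subset> I" "J \<noteq> {}" "card (\<Union>(N ` J)) = card J"
      by blast
    have finJ: "finite J"
      using J(1) fin(1) finite_subset by blast
    have "\<exists>f. inj_on f J \<and> (\<forall>i\<in>J. f i \<in> N i)"
      using less.hyps[of J N] J(1) fin hall by (metis psubset_card_mono finJ psubset_imp_subset subset_iff subset_trans)
    then obtain f where f: "inj_on f J" "\<forall>i\<in>J. f i \<in> N i"
      by blast
    define N' where "N' i = N i - \<Union>(N ` J)" for i
    \<comment> \<open>Hall's condition for \<open>J \<union> K\<close>, less the equality for
      \<open>J\<close>.\<close>
    have "card K \<le> card (\<Union>(N' ` K))" if "K \<subseteq> I - J" for K
    proof -
      have "card (J \<union> K) = card J + card K"
        using that fin(1) finJ by (intro card_Un_disjoint) (auto intro: finite_subset)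
      moreover have "card (J \<union> K) \<le> card (\<Union>(N ` (J \<union> K)))"
        using that J(1) by (intro hall) auto
      moreover have "\<Union>(N ` (J \<union> K)) = \<Union>(N ` J) \<union> \<Union>(N' ` K)"
        by (auto simp: N'_def)
      ultimately show ?thesis
        using card_Un_le[of "\<Union>(N ` J)" "\<Union>(N' ` K)"] J(3) by simp
    qed
    moreover have "card (I - J) < card I"
      using J(1,2) fin(1) by (intro psubset_card_mono) auto
    ultimately have "\<exists>g. inj_on g (I - J) \<and> (\<forall>i\<in>I - J. g i \<in> N' i)"
      using less.hyps[of "I - J" N'] fin by (simp add: N'_def)
    then obtain g where g: "inj_on g (I - J)" "\<forall>i\<in>I - J. g i \<in> N' i"
      by blast
    define h where "h i = (if i \<in> J then f i else g i)" for i
    have "inj_on h J" "inj_on h (I - J)"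
      using f(1) g(1) by (simp_all add: inj_on_def h_def)
    moreover have "h ` J \<subseteq> \<Union>(N ` J)" "h ` (I - J) \<inter> \<Union>(N ` J) = {}"
      using f(2) g(2) by (auto simp: h_def N'_def)
    ultimately have "inj_on h (J \<union> (I - J))"
      unfolding inj_on_Un by blast
    moreover have "J \<union> (I - J) = I"
      using J(1) by auto
    moreover have "\<forall>i\<in>I. h i \<in> N i"
      using f g by (auto simp: h_def N'_def)
    ultimately show ?thesis
      by auto
  next
    case noncritical: False
    show ?thesis
    proof (cases "I = {}")
      case True
      then show ?thesis
        by simp
    next
      case nonempty: False
      then obtain i where i: "i \<in> I"
        by blast
      have "N i \<noteq> {}"
        using hall[of "{i}"] i by auto
      then obtain x where x: "x \<in> N i"
        by blast
      define N' where "N' k = N k - {x}" for k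
      \<comment> \<open>Without a critical subset Hall's inequality is strict for nonempty
        \<open>K\<close>, so removing the single element \<open>x\<close> does no harm.\<close>
      have "card K \<le> card (\<Union>(N' ` K))" if "K \<subseteq> I - {i}" for K
      proof (cases "K = {}")
        case False
        moreover have "K \<subset> I"
          using that i by blast
        ultimately have "card (\<Union>(N ` K)) \<noteq> card K" "card K \<le> card (\<Union>(N ` K))"
          using noncritical hall[of K] by auto
        moreover have "\<Union>(N' ` K) = \<Union>(N ` K) - {x}"
          unfolding N'_def by blast
        moreover have "card (\<Union>(N ` K)) \<le> Suc (card (\<Union>(N ` K) - {x}))"
          by (simp add: card_Diff_singleton_if) linarith
        ultimately show ?thesis
          by simp
      qed simp
      moreover have "card (I - {i}) < card I"
        using i fin(1) by (meson card_Diff1_less)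
      ultimately have "\<exists>g. inj_on g (I - {i}) \<and> (\<forall>k\<in>I - {i}. g k \<in> N' k)"
        using less.hyps[of "I - {i}" N'] fin by (simp add: N'_def)
      then obtain g where g: "inj_on g (I - {i})" "\<forall>k\<in>I - {i}. g k \<in> N' k"
        by blast
      have "inj_on (g(i := x)) I"
        using g by (auto simp: inj_on_def N'_def)
      moreover have "\<forall>k\<in>I. (g(i := x)) k \<in> N k"
        using g x by (auto simp: N'_def)
      ultimately show ?thesis
        by blast
    qed
  qed
qed

section \<open>Odd families and Tutte's theorem\<close>

inductive perfect_matching :: "('v \<Rightarrow> 'v \<Rightarrow> bool) \<Rightarrow> 'v set \<Rightarrow> bool" for adj where
  empty: "perfect_matching adj {}"
| insert: "adj a b \<Longrightarrow> a \<noteq> b \<Longrightarrow> a \<notin> W \<Longrightarrow> b \<notin> W \<Longrightarrow> perfect_matching adj W \<Longrightarrow>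
    perfect_matching adj (insert a (insert b W))"

lemma perfect_matching_Un:
  assumes "perfect_matching adj A" "perfect_matching adj B" "A \<inter> B = {}"
  shows "perfect_matching adj (A \<union> B)"
  using assms
proof (induction rule: perfect_matching.induct)
  case (insert a b W)
  then show ?case
    using perfect_matching.insert[of adj a b "W \<union> B"] by simp
qed simp

lemma perfect_matching_UN:
  assumes "finite I" "\<And>i. i \<in> I \<Longrightarrow> perfect_matching adj (A i)" "disjoint_family_on A I"
  shows "perfect_matching adj (\<Union>i\<in>I. A i)"
  using assms
proof (induction I)
  case empty
  then show ?case
    by (simp add: perfect_matching.empty)
next
  case (insert i I)
  have "A i \<inter> (\<Union>i\<in>I. A i) = {}"
    using insert.prems(2) insert.hyps(2) by (auto simp: disjoint_family_on_def)
  moreover have "disjoint_family_on A I"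
    using insert.prems(2) by (auto simp: disjoint_family_on_def)
  ultimately show ?case
    using insert.IH insert.prems(1) perfect_matching_Un[of adj "A i"] by simp
qed

text \<open>
  Using families of odd sets that are closed outside \<open>S\<close>, rather than the odd components
  of the graph minus \<open>S\<close>, avoids any mention of connectivity.
\<close>

definition odd_family :: "('v \<Rightarrow> 'v \<Rightarrow> bool) \<Rightarrow> 'v set \<Rightarrow> 'v set \<Rightarrow> 'v set set \<Rightarrow> bool" where
  "odd_family adj V S \<C> \<longleftrightarrow> S \<subseteq> V \<and> pairwise disjnt \<C> \<and>
     (\<forall>C\<in>\<C>. C \<subseteq> V - S \<and> odd (card C) \<and> (\<forall>x\<in>C. \<forall>y\<in>V. adj x y \<longrightarrow> y \<in> C \<union> S))"

lemma odd_family_finite: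
  assumes "odd_family adj V S \<C>" "finite V"
  shows "finite \<C>" "finite S" "\<And>C. C \<in> \<C> \<Longrightarrow> finite C"
proof -
  have "\<C> \<subseteq> Pow V"
    using assms(1) by (auto simp: odd_family_def)
  then show "finite \<C>"
    using assms(2) finite_subset by auto
  show "finite S"
    using assms by (auto simp: odd_family_def intro: finite_subset)
  show "finite C" if "C \<in> \<C>" for C
    using \<open>\<C> \<subseteq> Pow V\<close> that assms(2) finite_subset by blast
qed

text \<open>The members are disjoint and odd, so their union has the parity of
  \<open>card \<C>\<close>. For even \<open>V\<close>, an excess of exactly one over
  \<open>S\<close> makes the uncovered part odd.\<close>

lemma odd_family_parity:
  assumes "odd_family adj V S \<C>" "finite V"
  shows "even (card V) \<longleftrightarrow> even (card S + card \<C> + card (V - S - \<Union>\<C>))"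
proof -
  note fin = odd_family_finite[OF assms]
  have sub: "S \<union> \<Union>\<C> \<subseteq> V" "S \<inter> \<Union>\<C> = {}"
    using assms(1) by (auto simp: odd_family_def)
  have "card (\<Union>\<C>) = (\<Sum>C\<in>\<C>. card C)"
    using assms(1) fin by (intro card_Union_disjoint) (auto simp: odd_family_def)
  moreover have "even (\<Sum>C\<in>\<C>. card C) \<longleftrightarrow> even (card \<C>)"
  proof -
    have "{C \<in> \<C>. odd (card C)} = \<C>"
      using assms(1) by (auto simp: odd_family_def)
    then show ?thesis
      using fin(1) by (simp add: even_sum_iff)
  qed
  moreover have "card V = card S + card (\<Union>\<C>) + card (V - S - \<Union>\<C>)"
  proof -
    have "card (S \<union> \<Union>\<C>) = card S + card (\<Union>\<C>)"
      using sub fin by (intro card_Un_disjoint) auto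
    moreover have "card V = card (S \<union> \<Union>\<C>) + card (V - (S \<union> \<Union>\<C>))"
      using sub(1) assms(2) by (metis Diff_disjoint Diff_partition card_Un_disjoint finite_Un)
    ultimately show ?thesis
      by (simp add: Diff_eq Int_assoc)
  qed
  ultimately show ?thesis
    by simp
qed

text \<open>The uncovered part has no edge to a member \<open>C\<close>: by symmetry such an edge
  would leave \<open>C\<close> without ending in \<open>S\<close>. With the parity lemma this raises
  an excess of one to two when \<open>V\<close> is even.\<close>

lemma odd_family_insert_rest:
  assumes fam: "odd_family adj V S \<C>" and "finite V" and sym: "symp adj"
    and odd: "odd (card (V - S - \<Union>\<C>))"
  shows "odd_family adj V S (insert (V - S - \<Union>\<C>) \<C>)"
    and "card (insert (V - S - \<Union>\<C>) \<C>) = Suc (card \<C>)"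
proof -
  let ?E = "V - S - \<Union>\<C>"
  have "?E \<noteq> {}"
    using odd by (metis card.empty even_zero)
  then have "?E \<notin> \<C>"
    by blast
  then show "card (insert ?E \<C>) = Suc (card \<C>)"
    using odd_family_finite(1)[OF assms(1,2)] by simp
  have closed: "y \<in> ?E \<union> S" if "x \<in> ?E" "y \<in> V" "adj x y" for x y
  proof (rule ccontr)
    assume "y \<notin> ?E \<union> S"
    then obtain C where "C \<in> \<C>" "y \<in> C"
      using \<open>y \<in> V\<close> by auto
    moreover have "adj y x"
      using that sym by (auto dest: sympD)
    ultimately have "x \<in> C \<union> S"
      using fam that unfolding odd_family_def by blast
    then show False
      using that \<open>C \<in> \<C>\<close> by auto
  qed
  have "pairwise disjnt (insert ?E \<C>)"
    using fam by (auto simp: odd_family_def pairwise_insert disjnt_def)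
  then show "odd_family adj V S (insert ?E \<C>)"
    using fam closed odd unfolding odd_family_def by auto
qed

text \<open>Tutte's theorem, proved along a maximal tight family; Hall's theorem matches its members to \<open>S\<close>.\<close>

lemma perfect_matching_if_odd_families:
  assumes "finite V" "symp adj"
    and "\<And>S \<C>. odd_family adj V S \<C> \<Longrightarrow> card \<C> \<le> card S"
  shows "perfect_matching adj V"
  using assms
proof (induction "card V" arbitrary: V rule: less_induct)
  case less
  note fin = less.prems(1) and sym = less.prems(2) and tutte = less.prems(3)
  \<comment> \<open>If \<open>card V\<close> were odd, \<open>{V}\<close> would be an odd family for
    the empty set.\<close>
  have even_V: "even (card V)"
    using tutte[of "{}" "{V}"] by (auto simp: odd_family_def)
  define tight where "tight S \<C> \<longleftrightarrow> odd_family adj V S \<C> \<and> card \<C> = card S" for S \<C>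
  \<comment> \<open>The empty family is tight, so there is a tight family with \<open>card S\<close>
    as large as possible.\<close>
  have "tight {} {}"
    by (simp add: tight_def odd_family_def)
  moreover have "card S \<le> card V" if "tight S \<C>" for S \<C>
    using that fin by (auto simp: tight_def odd_family_def intro: card_mono)
  ultimately have "\<exists>x. (\<lambda>(S, \<C>). tight S \<C>) x \<and> (\<forall>y. (\<lambda>(S, \<C>). tight S \<C>) y \<longrightarrow> card (fst y) \<le> card (fst x))"
    by (intro ex_has_greatest_nat[where k = "({}, {})" and b = "Suc (card V)"]) (auto simp: less_Suc_eq_le)
  then obtain S \<C> where "tight S \<C>" and max: "\<And>T \<D>. tight T \<D> \<Longrightarrow> card T \<le> card S"
    by auto
  then have fam: "odd_family adj V S \<C>" and card_eq: "card \<C> = card S"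
    by (auto simp: tight_def)
  note finC = odd_family_finite[OF fam fin]
  \<comment> \<open>The uncovered part is even. If it contained \<open>v\<close>, moving
    \<open>v\<close> into \<open>S\<close> and adding the odd remainder as a member would give a
    larger tight family.\<close>
  have cover: "V - S - \<Union>\<C> = {}"
  proof (rule ccontr)
    let ?E = "V - S - \<Union>\<C>"
    assume "?E \<noteq> {}"
    then obtain v where v: "v \<in> ?E"
      by blast
    have fam': "odd_family adj V (insert v S) \<C>"
      using fam v unfolding odd_family_def by auto
    have "even (card ?E)"
      using odd_family_parity[OF fam fin] even_V card_eq by simp
    moreover have "card ?E = Suc (card (?E - {v}))"
      using v fin by (intro card.remove) auto
    moreover have "?E - {v} = V - insert v S - \<Union>\<C>"
      by auto
    ultimately have "odd (card (V - insert v S - \<Union>\<C>))"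
      by simp
    from odd_family_insert_rest[OF fam' fin sym this]
    have "tight (insert v S) (insert (V - insert v S - \<Union>\<C>) \<C>)"
      using v finC(2) by (simp add: tight_def card_eq)
    then show False
      using max v finC(2) by fastforce
  qed
  \<comment> \<open>If Tutte's condition failed in the even set \<open>C - {v}\<close>, parity would
    give there a family \<open>\<E>\<close> with at least \<open>card T + 2\<close> members.
    Replacing \<open>C\<close> by \<open>\<E>\<close> and \<open>S\<close> by
    \<open>insert v (S \<union> T)\<close> leaves at least \<open>card S + card T + 1\<close>
    members, hence a larger tight family.\<close>
  have part: "perfect_matching adj (C - {v})" if C: "C \<in> \<C>" "v \<in> C" for C v
  proof -
    have sub: "C \<subseteq> V - S" "odd (card C)" "finite C"
      using fam C(1) finC(3) by (auto simp: odd_family_def)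
    have "card \<D> \<le> card T" if fam_D: "odd_family adj (C - {v}) T \<D>" for T \<D>
    proof (rule ccontr)
      assume gt: "\<not> card \<D> \<le> card T"
      have fin': "finite (C - {v})"
        using sub by simp
      have even: "even (card (C - {v}))"
        using sub C(2) by simp
      obtain \<E> where \<E>: "odd_family adj (C - {v}) T \<E>" "card \<E> \<ge> card T + 2"
      proof (cases "card \<D> \<ge> card T + 2")
        case True
        then show ?thesis
          using that fam_D by blast
      next
        case False
        then have "card \<D> = Suc (card T)"
          using gt by simp
        moreover from this have "odd (card ((C - {v}) - T - \<Union>\<D>))"
          using odd_family_parity[OF fam_D fin'] even by simp
        ultimately show ?thesis
          using that odd_family_insert_rest[OF fam_D fin' sym] by simp
      qed
      note finE = odd_family_finite[OF \<E>(1) fin']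
      let ?S = "insert v (S \<union> T)" and ?\<C> = "(\<C> - {C}) \<union> \<E>"
      have sub_E: "D \<subseteq> C - {v} - T" "odd (card D)" if "D \<in> \<E>" for D
        using that \<E>(1) by (auto simp: odd_family_def)
      have T: "T \<subseteq> C - {v}"
        using \<E>(1) by (auto simp: odd_family_def)
      have disj_C: "disjnt C B" if "B \<in> \<C> - {C}" for B
        using fam that C(1) by (auto simp: odd_family_def pairwise_def)
      have fam_new: "odd_family adj V ?S ?\<C>"
      proof -
        have "pairwise disjnt ?\<C>"
        proof (rule pairwiseI)
          fix A B
          assume AB: "A \<in> ?\<C>" "B \<in> ?\<C>" "A \<noteq> B"
          have "pairwise disjnt \<C>" "pairwise disjnt \<E>"
            using fam \<E>(1) by (simp_all add: odd_family_def)
          moreover have "disjnt X D" if "X \<in> \<C> - {C}" "D \<in> \<E>" for X D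
            using disj_C[OF that(1)] sub_E(1)[OF that(2)] unfolding disjnt_def by blast
          ultimately show "disjnt A B"
            using AB by (metis Diff_iff Un_iff disjnt_sym pairwiseD)
        qed
        moreover have "?S \<subseteq> V"
          using fam sub(1) C(2) T by (auto simp: odd_family_def)
        moreover have "B \<subseteq> V - ?S \<and> odd (card B) \<and> (\<forall>x\<in>B. \<forall>y\<in>V. adj x y \<longrightarrow> y \<in> B \<union> ?S)"
          if "B \<in> ?\<C>" for B
        proof (cases "B \<in> \<E>")
          case True
          have "y \<in> B \<union> ?S" if "x \<in> B" "y \<in> V" "adj x y" for x y
          proof -
            have "y \<in> C \<union> S"
              using that True sub_E(1) fam C(1) unfolding odd_family_def by blast
            then show ?thesis
              using that True \<E>(1) unfolding odd_family_def by blast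
          qed
          then show ?thesis
            using True sub_E sub(1) by blast
        next
          case False
          then have B: "B \<in> \<C>" "B \<noteq> C"
            using that by blast+
          then have "B \<inter> C = {}" "B \<subseteq> V - S" "odd (card B)"
            "\<And>x y. x \<in> B \<Longrightarrow> y \<in> V \<Longrightarrow> adj x y \<Longrightarrow> y \<in> B \<union> S"
            using disj_C[of B] fam by (auto simp: odd_family_def disjnt_def)
          then show ?thesis
            using C(2) T by blast
        qed
        ultimately show ?thesis
          by (simp add: odd_family_def)
      qed
      have "(\<C> - {C}) \<inter> \<E> = {}"
      proof -
        have "D \<notin> \<C> - {C}" if "D \<in> \<E>" for D
        proof
          assume "D \<in> \<C> - {C}"
          then have "D = {}"
            using disj_C sub_E(1)[OF that] by (auto simp: disjnt_def)
          then show False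
            using sub_E(2)[OF that] by simp
        qed
        then show ?thesis
          by blast
      qed
      then have "card ?\<C> = card S - 1 + card \<E>"
        using C(1) finC(1) finE(1) by (simp add: card_Un_disjoint card_eq)
      moreover have "card ?S = Suc (card S + card T)"
      proof -
        have "S \<inter> T = {}" "v \<notin> S \<union> T"
          using T sub(1) C(2) by auto
        then show ?thesis
          using finC(2) finE(2) by (simp add: card_Un_disjoint)
      qed
      moreover have "card S > 0"
        using C(1) finC(1) card_eq by (metis card_gt_0_iff empty_iff)
      ultimately have "tight ?S ?\<C>"
        using tutte[OF fam_new] \<E>(2) fam_new by (simp add: tight_def)
      then show False
        using max \<open>card ?S = _\<close> by fastforce
    qed
    moreover have "card (C - {v}) < card V"
    proof (rule psubset_card_mono[OF fin])
      show "C - {v} \<subset> V"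
        using sub(1) C(2) by blast
    qed
    ultimately show ?thesis
      using less.hyps[of "C - {v}"] sym sub(3) by simp
  qed
  \<comment> \<open>A subfamily \<open>\<A>\<close> is an odd family for its own neighbourhood in
    \<open>S\<close>, so the hypothesis on odd families is Hall's condition for
    \<open>N\<close>.\<close>
  define N where "N C = {s \<in> S. \<exists>x\<in>C. adj x s}" for C
  have "card \<A> \<le> card (\<Union>(N ` \<A>))" if "\<A> \<subseteq> \<C>" for \<A>
  proof (rule tutte)
    have "pairwise disjnt \<A>"
      using fam that by (auto simp: odd_family_def intro: pairwise_subset)
    moreover have "\<Union>(N ` \<A>) \<subseteq> V"
      using fam by (auto simp: N_def odd_family_def)
    moreover have "C \<subseteq> V - \<Union>(N ` \<A>) \<and> odd (card C) \<and>
        (\<forall>x\<in>C. \<forall>y\<in>V. adj x y \<longrightarrow> y \<in> C \<union> \<Union>(N ` \<A>))" if C: "C \<in> \<A>" for C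
    proof -
      have "C \<in> \<C>"
        using C \<open>\<A> \<subseteq> \<C>\<close> by blast
      then have "C \<subseteq> V - S" "odd (card C)" "\<And>x y. x \<in> C \<Longrightarrow> y \<in> V \<Longrightarrow> adj x y \<Longrightarrow> y \<in> C \<union> S"
        using fam by (auto simp: odd_family_def)
      then show ?thesis
        using C by (fastforce simp: N_def)
    qed
    ultimately show "odd_family adj V (\<Union>(N ` \<A>)) \<A>"
      by (simp add: odd_family_def)
  qed
  then obtain f where f: "inj_on f \<C>" "\<And>C. C \<in> \<C> \<Longrightarrow> f C \<in> N C"
    using marriage[of \<C> N] finC by (auto simp: N_def)
  have f_S: "f ` \<C> = S"
    using f finC(2) card_eq by (intro card_subset_eq) (auto simp: N_def card_image)
  have "\<forall>C\<in>\<C>. \<exists>x. x \<in> C \<and> adj x (f C)"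
    using f(2) by (auto simp: N_def)
  then obtain g where g: "\<And>C. C \<in> \<C> \<Longrightarrow> g C \<in> C \<and> adj (g C) (f C)"
    by metis
  \<comment> \<open>\<open>f C\<close> is matched to its neighbour \<open>g C\<close>, and the rest
    of \<open>C\<close> is matched by \<open>part\<close>. As \<open>f\<close> maps onto
    \<open>S\<close> and nothing is left uncovered, these sets partition \<open>V\<close>.\<close>
  have "perfect_matching adj (insert (f C) C)" if "C \<in> \<C>" for C
  proof -
    have "f C \<in> S" "C \<subseteq> V - S"
      using that f_S fam by (auto simp: odd_family_def)
    moreover have "g C \<in> C" "adj (f C) (g C)"
      using g[OF that] sym by (auto dest: sympD)
    ultimately have "perfect_matching adj (insert (f C) (insert (g C) (C - {g C})))"
      using part[OF that] by (intro perfect_matching.insert) auto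
    then show ?thesis
      using \<open>g C \<in> C\<close> by (simp add: insert_absorb)
  qed
  moreover have "disjoint_family_on (\<lambda>C. insert (f C) C) \<C>"
  proof -
    have "insert (f C) C \<inter> insert (f D) D = {}" if "C \<in> \<C>" "D \<in> \<C>" "C \<noteq> D" for C D
    proof -
      have "f C \<noteq> f D" "f C \<in> S" "f D \<in> S" "C \<subseteq> V - S" "D \<subseteq> V - S" "C \<inter> D = {}"
        using that f f_S fam by (auto simp: odd_family_def inj_on_def pairwise_def disjnt_def)
      then show ?thesis
        by auto
    qed
    then show ?thesis
      by (simp add: disjoint_family_on_def)
  qed
  ultimately have "perfect_matching adj (\<Union>C\<in>\<C>. insert (f C) C)"
    by (intro perfect_matching_UN finC(1))
  moreover have "(\<Union>C\<in>\<C>. insert (f C) C) = V"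
    using f_S cover fam by (auto simp: odd_family_def)
  ultimately show ?case
    by simp
qed

subsection \<open>Edge cuts\<close>

text \<open>Lists of booleans give each cut edge a position, so that the colours seen from the two
  sides can be compared.\<close>

fun selected :: "'a list \<Rightarrow> bool list \<Rightarrow> 'a multiset" where
  "selected (x # xs) (b # bs) = (if b then {#x#} else {#}) + selected xs bs"
| "selected _ _ = {#}"

lemma selected_Not:
  "length xs = length bs \<Longrightarrow> selected xs bs + selected xs (map Not bs) = mset xs"
  by (induction xs bs rule: list_induct2) auto

lemma selected_subset: "length xs = length bs \<Longrightarrow> selected xs bs \<subseteq># mset xs"
  by (metis mset_subset_eq_add_left selected_Not)

lemma sum_selected_map2:
  assumes "length xs = length ys" "length ys = length bs"
  shows "\<Sum>\<^sub># (selected (map2 (\<lambda>x y. {#x, y#}) xs ys) bs) = selected xs bs + selected ys bs"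
  using assms by (induction xs ys bs rule: list_induct3) auto

lemma subseteq_add_mset_list:
  assumes "R \<subseteq># L + mset zs"
  shows "\<exists>Q bs. Q \<subseteq># L \<and> length bs = length zs \<and> R = Q + selected zs bs"
  using assms
proof (induction zs arbitrary: R)
  case Nil
  then show ?case
    by auto
next
  case (Cons z zs)
  then have "R \<subseteq># add_mset z (L + mset zs)"
    by simp
  then obtain b R' where R': "R' \<subseteq># L + mset zs" "R = (if b then {#z#} else {#}) + R'"
    by (rule subseteq_add_msetE)
  obtain Q bs where "Q \<subseteq># L" "length bs = length zs" "R' = Q + selected zs bs"
    using Cons.IH[OF R'(1)] by blast
  then show ?case
    using R'(2) by (intro exI[of _ Q] exI[of _ "b # bs"]) simp
qed

text \<open>
  Here \<open>L\<close> are the edges inside \<open>C\<close>, and \<open>xs\<close> are the ends in \<open>C\<close> of the edges that leave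
  \<open>C\<close>; the latter edges are red where \<open>bs\<close> is true.
\<close>

definition feasible :: "'v set \<Rightarrow> 'v multiset multiset \<Rightarrow> 'v list \<Rightarrow> bool list \<Rightarrow> bool" where
  "feasible C L xs bs \<longleftrightarrow>
     (\<exists>R. R \<subseteq># L \<and> (\<forall>v\<in>C. count (\<Sum>\<^sub># R + selected xs bs) v \<in> {4, 1}))"

text \<open>Exchanging colours turns red degree \<open>d\<close> into \<open>5 - d\<close>, which
  preserves \<open>{4, 1}\<close>.\<close>

lemma feasible_Not:
  assumes "finite C" "\<Sum>\<^sub># L + mset xs = repeat_mset 5 (mset_set C)" "length xs = length bs"
    and "feasible C L xs bs"
  shows "feasible C L xs (map Not bs)"
proof -
  obtain R where R: "R \<subseteq># L" "\<forall>v\<in>C. count (\<Sum>\<^sub># R + selected xs bs) v \<in> {4, 1}"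
    using assms(4) by (auto simp: feasible_def)
  have "\<Sum>\<^sub># L = \<Sum>\<^sub># R + \<Sum>\<^sub># (L - R)"
    using R(1) by (metis subset_mset.add_diff_inverse sum_mset.union)
  then have sum: "(\<Sum>\<^sub># R + selected xs bs) + (\<Sum>\<^sub># (L - R) + selected xs (map Not bs)) =
      repeat_mset 5 (mset_set C)"
    using assms(2) selected_Not[OF assms(3)] by (simp add: ac_simps)
  have "count (\<Sum>\<^sub># (L - R) + selected xs (map Not bs)) v \<in> {4, 1}" if "v \<in> C" for v
  proof -
    have "count (\<Sum>\<^sub># R + selected xs bs) v + count (\<Sum>\<^sub># (L - R) + selected xs (map Not bs)) v = 5"
      using arg_cong[OF sum, of "\<lambda>A. count A v"] that assms(1) by simp
    moreover have "count (\<Sum>\<^sub># R + selected xs bs) v \<in> {4, 1}"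
      using R(2) that by blast
    ultimately show ?thesis
      by auto
  qed
  moreover have "L - R \<subseteq># L"
    by simp
  ultimately show ?thesis
    unfolding feasible_def by blast
qed

text \<open>Up to complement there are four patterns, represented by those with at most one
  \<open>False\<close>. The conclusions say that \<open>P\<close> contains the constant pattern and
  some other one, or all three others; any two sets of this kind share a pattern.\<close>

lemma normalized_patterns:
  fixes P :: "bool \<Rightarrow> bool \<Rightarrow> bool \<Rightarrow> bool"
  assumes flip: "\<And>a b c. P a b c \<Longrightarrow> P (\<not> a) (\<not> b) (\<not> c)"
    and "\<exists>a b. P a a b" "\<exists>a b. P a b a" "\<exists>a b. P b a a" "\<exists>a b c. P a b c \<and> \<not> (a = b \<and> b = c)"
  shows "P True True True \<or> P True True False" "P True True True \<or> P True False True"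
    "P True True True \<or> P False True True"
    "P True True False \<or> P True False True \<or> P False True True"
proof -
  from assms(2) obtain a b where "P a a b"
    by blast
  then show "P True True True \<or> P True True False"
    using flip[of a a b] by (cases a; cases b) auto
  from assms(3) obtain a b where "P a b a"
    by blast
  then show "P True True True \<or> P True False True"
    using flip[of a b a] by (cases a; cases b) auto
  from assms(4) obtain a b where "P b a a"
    by blast
  then show "P True True True \<or> P False True True"
    using flip[of b a a] by (cases a; cases b) auto
  from assms(5) obtain a b c where "P a b c" "\<not> (a = b \<and> b = c)"
    by blast
  then show "P True True False \<or> P True False True \<or> P False True True"
    using flip[of a b c] by (cases a; cases b; cases c) auto
qed

section \<open>Cuts with one or three edges in the minimal graph\<close>

context minimal_multigraph
begin

text \<open>\<open>L\<close> and \<open>K\<close> are the edges inside the two sides. Entries of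
  \<open>xs\<close> and \<open>ys\<close> at the same position are the two ends of one crossing
  edge.\<close>

definition cut :: "'v set \<Rightarrow> 'v set \<Rightarrow> 'v multiset multiset \<Rightarrow> 'v multiset multiset \<Rightarrow>
    'v list \<Rightarrow> 'v list \<Rightarrow> bool" where
  "cut C D L K xs ys \<longleftrightarrow> C \<union> D = V \<and> C \<inter> D = {} \<and> length xs = length ys \<and>
     set_mset (\<Sum>\<^sub># L) \<subseteq> C \<and> set_mset (\<Sum>\<^sub># K) \<subseteq> D \<and> set xs \<subseteq> C \<and> set ys \<subseteq> D \<and>
     M = L + K + mset (map2 (\<lambda>x y. {#x, y#}) xs ys)"

lemma cut_sym:
  assumes "cut C D L K xs ys"
  shows "cut D C K L ys xs"
proof -
  have "length xs = length ys"
    using assms by (simp add: cut_def)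
  then have "map2 (\<lambda>x y. {#x, y#}) xs ys = map2 (\<lambda>x y. {#x, y#}) ys xs"
    by (induction xs ys rule: list_induct2) auto
  then show ?thesis
    using assms unfolding cut_def by (metis Int_commute Un_commute union_commute)
qed

lemma cut_exists:
  assumes "C \<subseteq> V"
  obtains L K xs ys where "cut C (V - C) L K xs ys"
proof -
  define L where "L = filter_mset (\<lambda>e. set_mset e \<subseteq> C) M"
  define M' where "M' = filter_mset (\<lambda>e. \<not> set_mset e \<subseteq> C) M"
  define K where "K = filter_mset (\<lambda>e. set_mset e \<subseteq> V - C) M'"
  define X where "X = filter_mset (\<lambda>e. \<not> set_mset e \<subseteq> V - C) M'"
  have M: "M = L + K + X"
    unfolding L_def K_def X_def M'_def by (metis multiset_partition union_assoc)
  have "\<exists>x\<in>C. \<exists>y\<in>V - C. e = {#x, y#}" if "e \<in># X" for e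
  proof -
    have e: "e \<in># M" "\<not> set_mset e \<subseteq> C" "\<not> set_mset e \<subseteq> V - C"
      using that by (auto simp: X_def M'_def)
    have "set_mset e \<subseteq> V"
      using e(1) by (rule edge_ends)
    then obtain x where x: "x \<in># e" "x \<in> C"
      using e(3) by blast
    then obtain y where "e = {#x, y#}"
      using e(1) pairs_M pair_mset unfolding pairs_def by metis
    then show ?thesis
      using x e \<open>set_mset e \<subseteq> V\<close> by auto
  qed
  then have "\<exists>xs ys. length xs = length ys \<and> set xs \<subseteq> C \<and> set ys \<subseteq> V - C \<and>
      X = mset (map2 (\<lambda>x y. {#x, y#}) xs ys)"
  proof (induction X)
    case empty
    then show ?case
      by (intro exI[of _ "[]"]) simp
  next
    case (add e X)
    then obtain xs ys where "length xs = length ys" "set xs \<subseteq> C" "set ys \<subseteq> V - C"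
      "X = mset (map2 (\<lambda>x y. {#x, y#}) xs ys)"
      by (metis union_iff add_mset_add_single)
    moreover obtain x y where "x \<in> C" "y \<in> V - C" "e = {#x, y#}"
      using add.prems by (metis union_single_eq_member)
    ultimately show ?case
      by (intro exI[of _ "x # xs"] exI[of _ "y # ys"]) simp
  qed
  then obtain xs ys where "length xs = length ys" "set xs \<subseteq> C" "set ys \<subseteq> V - C"
    "X = mset (map2 (\<lambda>x y. {#x, y#}) xs ys)"
    by blast
  moreover have "set_mset (\<Sum>\<^sub># L) \<subseteq> C" "set_mset (\<Sum>\<^sub># K) \<subseteq> V - C"
    by (auto simp: L_def K_def)
  ultimately have "cut C (V - C) L K xs ys"
    using M assms unfolding cut_def by blast
  then show ?thesis
    by (rule that)
qed

lemma sum_map2_pair: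
  "length xs = length ys \<Longrightarrow> \<Sum>\<^sub># (mset (map2 (\<lambda>x y. {#x, y#}) xs ys)) = mset xs + mset ys"
  by (induction xs ys rule: list_induct2) auto

lemma cut_sum:
  assumes "cut C D L K xs ys"
  shows "\<Sum>\<^sub># L + mset xs = repeat_mset 5 (mset_set C)"
proof (rule multiset_eqI)
  fix v
  have cut: "C \<union> D = V" "C \<inter> D = {}" "set_mset (\<Sum>\<^sub># L) \<subseteq> C" "set_mset (\<Sum>\<^sub># K) \<subseteq> D"
    "set xs \<subseteq> C" "set ys \<subseteq> D"
    using assms by (auto simp: cut_def)
  have fin: "finite C"
    using cut(1) finite_V by (metis finite_Un)
  have sum: "(\<Sum>\<^sub># L + mset xs) + (\<Sum>\<^sub># K + mset ys) = repeat_mset 5 (mset_set V)"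
    using assms sum_M sum_map2_pair[of xs ys] by (simp add: cut_def ac_simps)
  show "count (\<Sum>\<^sub># L + mset xs) v = count (repeat_mset 5 (mset_set C)) v"
  proof (cases "v \<in> C")
    case True
    then have "v \<notin># \<Sum>\<^sub># K + mset ys" "v \<in> V"
      using cut by auto
    then show ?thesis
      using arg_cong[OF sum, of "\<lambda>A. count A v"] True fin finite_V
      unfolding count_union[of "\<Sum>\<^sub># L + mset xs"] by (simp only: not_in_iff) simp
  next
    case False
    then have "v \<notin># \<Sum>\<^sub># L + mset xs"
      using cut by auto
    then show ?thesis
      using False by (simp only: not_in_iff) simp
  qed
qed

text \<open>Colourings of the two sides that agree on the crossing edges glue to a colouring of the
  whole graph.\<close>

lemma cut_incompatible:
  assumes cut: "cut C D L K xs ys" and "length bs = length xs"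
    and "feasible C L xs bs" "feasible D K ys bs"
  shows False
proof -
  have sets: "C \<union> D = V" "C \<inter> D = {}" "set_mset (\<Sum>\<^sub># L) \<subseteq> C" "set_mset (\<Sum>\<^sub># K) \<subseteq> D"
    "set xs \<subseteq> C" "set ys \<subseteq> D" and len: "length xs = length ys"
    using cut by (auto simp: cut_def)
  obtain R where R: "R \<subseteq># L" "\<forall>v\<in>C. count (\<Sum>\<^sub># R + selected xs bs) v \<in> {4, 1}"
    using assms(3) by (auto simp: feasible_def)
  obtain Q where Q: "Q \<subseteq># K" "\<forall>v\<in>D. count (\<Sum>\<^sub># Q + selected ys bs) v \<in> {4, 1}"
    using assms(4) by (auto simp: feasible_def)
  let ?zs = "map2 (\<lambda>x y. {#x, y#}) xs ys"
  let ?T = "R + Q + selected ?zs bs"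
  have "selected ?zs bs \<subseteq># mset ?zs"
    using assms(2) len by (intro selected_subset) simp
  then have "?T \<subseteq># M"
    using R(1) Q(1) cut unfolding cut_def by (simp add: subset_mset.add_mono)
  moreover have "count (\<Sum>\<^sub># ?T) v \<in> {4, 1}" if "v \<in> V" for v
  proof -
    have "\<Sum>\<^sub># (selected ?zs bs) = selected xs bs + selected ys bs"
      by (rule sum_selected_map2) (use len assms(2) in simp_all)
    then have sum: "\<Sum>\<^sub># ?T = (\<Sum>\<^sub># R + selected xs bs) + (\<Sum>\<^sub># Q + selected ys bs)"
      unfolding sum_mset.union by (metis (no_types) union_assoc union_commute)
    have "set_mset (\<Sum>\<^sub># R + selected xs bs) \<subseteq> C"
      using sets(3,5) set_mset_mono[OF R(1)] set_mset_mono[OF selected_subset[of xs bs]] assms(2)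
      by auto
    moreover have "set_mset (\<Sum>\<^sub># Q + selected ys bs) \<subseteq> D"
      using sets(4,6) set_mset_mono[OF Q(1)] set_mset_mono[OF selected_subset[of ys bs]] assms(2) len
      by auto
    ultimately have "v \<in> C \<and> v \<notin># \<Sum>\<^sub># Q + selected ys bs \<or> v \<in> D \<and> v \<notin># \<Sum>\<^sub># R + selected xs bs"
      using that sets(1,2) by blast
    then show ?thesis
      unfolding sum count_union[of _ "\<Sum>\<^sub># Q + selected ys bs"] not_in_iff
      using R(2) Q(2) by auto
  qed
  ultimately show False
    using not_colourable unfolding colourable_def by blast
qed

text \<open>\<open>C\<close> is completed by one new vertex \<open>p\<close>, and \<open>zs\<close>
  are the edges that take up the cut ends and five ends at \<open>p\<close>. The result is 5-regular
  and, as \<open>card C + 1 < card V\<close>, colourable.\<close>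

lemma cut_completion:
  assumes cut: "cut C D L K xs ys" and "card C + 1 < card V" "p \<notin> C"
    and zs: "\<forall>e\<in>set zs. size e = 2" "\<Sum>\<^sub># (mset zs) = mset xs + repeat_mset 5 {#p#}"
  obtains R bs where "R \<subseteq># L" "length bs = length zs"
    "\<And>v. v \<in> C \<Longrightarrow> count (\<Sum>\<^sub># R + \<Sum>\<^sub># (selected zs bs)) v \<in> {4, 1}"
    "count (\<Sum>\<^sub># (selected zs bs)) p \<in> {4, 1}"
proof -
  have fin: "finite C"
    using cut finite_V unfolding cut_def by (metis finite_Un)
  have "pairs L"
    using pairs_M cut by (auto simp: pairs_def cut_def)
  then have "pairs (L + mset zs)"
    using zs(1) by (auto simp: pairs_def)
  moreover have "\<Sum>\<^sub># (L + mset zs) = repeat_mset 5 (mset_set (insert p C))"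
    using cut_sum[OF cut] zs(2) fin assms(3) by (simp flip: add.assoc)
  moreover have "card (insert p C) < card V"
    using assms(2,3) fin by simp
  ultimately have "colourable {4, 1} (insert p C) (L + mset zs)"
    using smaller_colourable fin by simp
  then obtain T where T: "T \<subseteq># L + mset zs" "\<forall>v\<in>insert p C. count (\<Sum>\<^sub># T) v \<in> {4, 1}"
    by (auto simp: colourable_def)
  obtain R bs where R: "R \<subseteq># L" "length bs = length zs" "T = R + selected zs bs"
    using subseteq_add_mset_list[OF T(1)] by blast
  have "p \<notin># \<Sum>\<^sub># R"
    using set_mset_mono[OF R(1)] cut assms(3) unfolding cut_def by auto
  then have "count (\<Sum>\<^sub># R) p = 0"
    by (simp only: not_in_iff)
  then show ?thesis
    using that[OF R(1,2)] T(2) unfolding R(3) by simp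
qed

text \<open>The new vertex carries two loops and absorbs the cut edge; the outer end
  \<open>y\<close> lends its name. A colouring gives one feasible colour of the cut edge, and
  exchanging colours gives the other.\<close>

lemma cut_1:
  assumes cut: "cut C D L K [x] [y]" and "card C + 1 < card V"
  shows "feasible C L [x] [b]"
proof -
  have "y \<notin> C"
    using cut by (auto simp: cut_def)
  let ?zs = "[{#x, y#}, {#y, y#}, {#y, y#}]"
  have "\<forall>e\<in>set ?zs. size e = 2" "\<Sum>\<^sub># (mset ?zs) = mset [x] + repeat_mset 5 {#y#}"
    by (simp_all add: numeral_eq_Suc)
  from cut_completion[OF cut assms(2) \<open>y \<notin> C\<close> this]
  obtain R bs where R: "R \<subseteq># L" "length bs = length ?zs"
    "\<And>v. v \<in> C \<Longrightarrow> count (\<Sum>\<^sub># R + \<Sum>\<^sub># (selected ?zs bs)) v \<in> {4, 1}"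
    by metis
  obtain b1 b2 b3 where bs: "bs = [b1, b2, b3]"
    using R(2) by (auto simp: numeral_eq_Suc length_Suc_conv)
  have "count (\<Sum>\<^sub># R + selected [x] [b1]) v \<in> {4, 1}" if "v \<in> C" for v
    using R(3)[OF that] \<open>y \<notin> C\<close> that by (auto simp: bs split: if_splits)
  then have "feasible C L [x] [b1]"
    using R(1) unfolding feasible_def by blast
  moreover from this have "feasible C L [x] [\<not> b1]"
    using feasible_Not[OF _ cut_sum[OF cut], of "[b1]"] cut finite_V by (auto simp: cut_def)
  ultimately show ?thesis
    by (cases b; cases b1) auto
qed

lemma cut_3:
  assumes cut: "cut C D L K [x1, x2, x3] [y1, y2, y3]" and "card C + 1 < card V"
  defines "P \<equiv> \<lambda>a b c. feasible C L [x1, x2, x3] [a, b, c]"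
  shows "P a b c \<Longrightarrow> P (\<not> a) (\<not> b) (\<not> c)" "\<exists>a b. P a a b" "\<exists>a b. P a b a" "\<exists>a b. P b a a"
    "\<exists>a b c. P a b c \<and> \<not> (a = b \<and> b = c)"
proof -
  show "P a b c \<Longrightarrow> P (\<not> a) (\<not> b) (\<not> c)"
    using feasible_Not[OF _ cut_sum[OF cut], of "[a, b, c]"] cut finite_V by (auto simp: cut_def P_def)
  define p where "p = y1"
  have p: "p \<notin> C"
    using cut by (auto simp: cut_def p_def)
  \<comment> \<open>Two cut ends are joined to each other, which forces equal colours, and the third
    is attached to a vertex with two loops. The permutation chooses which two are joined.\<close>
  have paired: "\<exists>R a b. R \<subseteq># L \<and> (\<forall>v\<in>C. count (\<Sum>\<^sub># R + selected [x, x', x''] [a, a, b]) v \<in> {4, 1})"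
    if perm: "mset [x, x', x''] = mset [x1, x2, x3]" for x x' x''
  proof -
    let ?zs = "[{#x, x'#}, {#x'', p#}, {#p, p#}, {#p, p#}]"
    have "\<forall>e\<in>set ?zs. size e = 2" "\<Sum>\<^sub># (mset ?zs) = mset [x1, x2, x3] + repeat_mset 5 {#p#}"
      unfolding perm[symmetric] by (simp_all add: numeral_eq_Suc add_mset_commute)
    from cut_completion[OF cut assms(2) p this]
    obtain R bs where R: "R \<subseteq># L" "length bs = length ?zs"
      "\<And>v. v \<in> C \<Longrightarrow> count (\<Sum>\<^sub># R + \<Sum>\<^sub># (selected ?zs bs)) v \<in> {4, 1}"
      by metis
    obtain b1 b2 b3 b4 where bs: "bs = [b1, b2, b3, b4]"
      using R(2) by (auto simp: numeral_eq_Suc length_Suc_conv)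
    have "count (\<Sum>\<^sub># R + selected [x, x', x''] [b1, b1, b2]) v \<in> {4, 1}" if "v \<in> C" for v
      using R(3)[OF that] p that by (auto simp: bs split: if_splits)
    then show ?thesis
      using R(1) by blast
  qed
  show "\<exists>a b. P a a b"
    using paired[OF refl] unfolding P_def feasible_def by blast
  have "mset [x1, x3, x2] = mset [x1, x2, x3]"
    and sel: "\<And>a b. selected [x1, x3, x2] [a, a, b] = selected [x1, x2, x3] [a, b, a]"
    by simp_all
  from paired[OF this(1)] show "\<exists>a b. P a b a"
    unfolding sel P_def feasible_def by blast
  have "mset [x2, x3, x1] = mset [x1, x2, x3]"
    and sel: "\<And>a b. selected [x2, x3, x1] [a, a, b] = selected [x1, x2, x3] [b, a, a]"
    by simp_all
  from paired[OF this(1)] show "\<exists>a b. P b a a"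
    unfolding sel P_def feasible_def by blast
  \<comment> \<open>All three cut ends are attached to a vertex with one loop. Three equal colours
    would give it red degree 0, 2, 3 or 5.\<close>
  let ?zs = "[{#x1, p#}, {#x2, p#}, {#x3, p#}, {#p, p#}]"
  have "\<forall>e\<in>set ?zs. size e = 2" "\<Sum>\<^sub># (mset ?zs) = mset [x1, x2, x3] + repeat_mset 5 {#p#}"
    by (simp_all add: numeral_eq_Suc add_mset_commute)
  from cut_completion[OF cut assms(2) p this]
  obtain R bs where R: "R \<subseteq># L" "length bs = length ?zs"
    "\<And>v. v \<in> C \<Longrightarrow> count (\<Sum>\<^sub># R + \<Sum>\<^sub># (selected ?zs bs)) v \<in> {4, 1}"
    "count (\<Sum>\<^sub># (selected ?zs bs)) p \<in> {4, 1}"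
    by metis
  obtain b1 b2 b3 b4 where bs: "bs = [b1, b2, b3, b4]"
    using R(2) by (auto simp: numeral_eq_Suc length_Suc_conv)
  have "count (\<Sum>\<^sub># R + selected [x1, x2, x3] [b1, b2, b3]) v \<in> {4, 1}" if "v \<in> C" for v
    using R(3)[OF that] p that by (auto simp: bs split: if_splits)
  then have "P b1 b2 b3"
    using R(1) unfolding P_def feasible_def by blast
  moreover have "x1 \<noteq> p" "x2 \<noteq> p" "x3 \<noteq> p"
    using cut p by (auto simp: cut_def)
  then have "\<not> (b1 = b2 \<and> b2 = b3)"
    using R(4) by (auto simp: bs split: if_splits)
  ultimately show "\<exists>a b c. P a b c \<and> \<not> (a = b \<and> b = c)"
    by blast
qed

text \<open>With two vertices on each side both completions are smaller than the graph. For one edge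
  every colour is feasible on both sides; for three edges \<open>normalized_patterns\<close>
  supplies a common pattern.\<close>

lemma no_small_cut:
  assumes cut: "cut C D L K xs ys" and card: "2 \<le> card C" "2 \<le> card D"
    and len: "length xs = 1 \<or> length xs = 3"
  shows False
proof -
  have "card V = card C + card D"
    using cut finite_V unfolding cut_def by (metis card_Un_disjoint finite_Un)
  then have small: "card C + 1 < card V" "card D + 1 < card V"
    using card by auto
  have len_eq: "length ys = length xs"
    using cut by (simp add: cut_def)
  from len show False
  proof
    assume "length xs = 1"
    then obtain x y where xs: "xs = [x]" "ys = [y]"
      using len_eq by (auto simp: length_Suc_conv)
    note cutC = cut[unfolded xs] and cutD = cut_sym[OF cut, unfolded xs]
    show False
      using cut_incompatible[OF cutC _ cut_1[OF cutC small(1)] cut_1[OF cutD small(2)], of True]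
      by simp
  next
    assume "length xs = 3"
    then obtain x1 x2 x3 y1 y2 y3 where xs: "xs = [x1, x2, x3]" "ys = [y1, y2, y3]"
      using len_eq by (auto simp: numeral_eq_Suc length_Suc_conv)
    note cutC = cut[unfolded xs] and cutD = cut_sym[OF cut, unfolded xs]
    define P Q where "P a b c \<longleftrightarrow> feasible C L [x1, x2, x3] [a, b, c]"
      and "Q a b c \<longleftrightarrow> feasible D K [y1, y2, y3] [a, b, c]" for a b c
    have "\<not> (P a b c \<and> Q a b c)" for a b c
      using cut_incompatible[OF cutC, of "[a, b, c]"] by (auto simp: P_def Q_def)
    then show False
      using normalized_patterns[of P, unfolded P_def, OF cut_3[OF cutC small(1)]]
        normalized_patterns[of Q, unfolded Q_def, OF cut_3[OF cutD small(2)]]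
      unfolding P_def Q_def by blast
  qed
qed

end

subsection \<open>Counting loops\<close>

lemma sum_swap_mset: "(\<Sum>x\<in>A. \<Sum>e\<in>#M. f x e) = (\<Sum>e\<in>#M. \<Sum>x\<in>A. f x e)"
  for f :: "'a \<Rightarrow> 'b \<Rightarrow> 'c::comm_monoid_add"
  by (induction M) (auto simp: sum.distrib)

context minimal_multigraph
begin

text \<open>Summed over \<open>M\<close>, this is the number of edges leaving \<open>C\<close> plus
  twice the number of loops at \<open>C\<close>.\<close>

definition weight :: "'v set \<Rightarrow> 'v multiset \<Rightarrow> nat" where
  "weight C e = (if \<exists>x\<in>C. \<exists>y\<in>V - C. e = {#x, y#} then 1 else if \<exists>x\<in>C. e = {#x, x#} then 2 else 0)"

lemma even_card_V: "even (card V)"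
proof -
  have "2 * size M = 5 * card V"
    using size_sum_pairs[OF pairs_M] sum_M by simp
  then show ?thesis
    by (metis dvd_triv_left even_mult_iff odd_numeral)
qed

lemma cut_parity:
  assumes "cut C D L K xs ys"
  shows "5 * card C = 2 * size L + length xs"
proof -
  have "pairs L"
    using pairs_M assms by (auto simp: pairs_def cut_def)
  then have "size (\<Sum>\<^sub># L + mset xs) = 2 * size L + length xs"
    using size_sum_pairs[of L] by (simp only: size_union size_mset)
  then show ?thesis
    unfolding cut_sum[OF assms] by simp
qed

lemma sum_weight_cut:
  assumes "length xs = length ys" "set xs \<subseteq> C" "set ys \<subseteq> V - C"
  shows "(\<Sum>e\<in>#mset (map2 (\<lambda>x y. {#x, y#}) xs ys). weight C e) = length xs"
  using assms
  by (induction xs ys rule: list_induct2) (auto simp: weight_def)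

text \<open>By parity the number of leaving edges is odd. If it is 1 or 3, \<open>C\<close> is a
  single vertex, all its inner edges are loops, and the weight is its degree 5.\<close>

lemma sum_weight_ge:
  assumes C: "C \<subseteq> V" "odd (card C)" and two: "2 \<le> card (V - C)"
  shows "5 \<le> (\<Sum>e\<in>#M. weight C e)"
proof -
  obtain L K xs ys where cut: "cut C (V - C) L K xs ys"
    using C(1) by (rule cut_exists)
  have M: "M = L + K + mset (map2 (\<lambda>x y. {#x, y#}) xs ys)"
    and xs: "length xs = length ys" "set xs \<subseteq> C" "set ys \<subseteq> V - C"
    and L: "set_mset (\<Sum>\<^sub># L) \<subseteq> C"
    using cut by (auto simp: cut_def)
  have ge: "length xs + (\<Sum>e\<in>#L. weight C e) \<le> (\<Sum>e\<in>#M. weight C e)"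
    using sum_weight_cut[OF xs] by (simp add: M)
  note parity = cut_parity[OF cut]
  have "odd (length xs)"
    using C(2) parity by (metis even_add even_mult_iff even_numeral odd_numeral)
  then have "5 \<le> length xs \<or> length xs = 1 \<or> length xs = 3"
    by presburger
  then consider "5 \<le> length xs" | "length xs = 1 \<or> length xs = 3"
    by blast
  then show ?thesis
  proof cases
    case 1
    then show ?thesis
      using ge by linarith
  next
    case 2
    then have "\<not> 2 \<le> card C"
      using no_small_cut[OF cut _ two] by blast
    then have "card C = 1"
      using C(2) by (metis One_nat_def Suc_1 even_zero less_2_cases not_less)
    then obtain v where v: "C = {v}"
      by (auto simp: card_1_singleton_iff)
    have "weight C e = 2" if e: "e \<in># L" for e
    proof -
      have "set_mset e \<subseteq> {v}" "size e = 2"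
        using e L v pairs_M M by (auto simp: pairs_def)
      then have "e = {#v, v#}"
        by (metis set_mset_subset_singletonD replicate_mset_0 replicate_mset_Suc numeral_2_eq_2)
      then show ?thesis
        by (simp add: weight_def v)
    qed
    then have "(\<Sum>e\<in>#L. weight C e) = (\<Sum>e\<in>#L. 2)"
      by (intro arg_cong[where f = sum_mset] image_mset_cong)
    then have "(\<Sum>e\<in>#L. weight C e) = 2 * size L"
      by simp
    then show ?thesis
      using ge parity \<open>card C = 1\<close> by simp
  qed
qed

lemma crossing_edge:
  assumes "C \<subseteq> V" "odd (card C)"
  obtains x y where "x \<in> C" "y \<in> V - C" "{#x, y#} \<in># M"
proof -
  obtain L K xs ys where cut: "cut C (V - C) L K xs ys"
    using assms(1) by (rule cut_exists)
  have "odd (length xs)"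
    using assms(2) cut_parity[OF cut] by (metis even_add even_mult_iff even_numeral odd_numeral)
  then obtain x xs' where xs: "xs = x # xs'"
    by (cases xs) auto
  then obtain y ys' where ys: "ys = y # ys'"
    using cut by (cases ys) (auto simp: cut_def)
  then show ?thesis
    using that[of x y] cut xs by (auto simp: cut_def)
qed

lemma perfect_matching_subset:
  assumes "perfect_matching (\<lambda>x y. {#x, y#} \<in># M) W" "finite W"
  shows "\<exists>R. R \<subseteq># M \<and> \<Sum>\<^sub># R = mset_set W"
  using assms
proof (induction rule: perfect_matching.induct)
  case empty
  then show ?case
    by (intro exI[of _ "{#}"]) simp
next
  case (insert a b W)
  then obtain R where R: "R \<subseteq># M" "\<Sum>\<^sub># R = mset_set W"
    by auto
  have "finite W"
    using insert.prems by simp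
  then have "a \<notin># \<Sum>\<^sub># R"
    using R(2) insert.hyps by simp
  then have "{#a, b#} \<notin># R"
    by auto
  then have "{#a, b#} \<in># M - R"
    using insert.hyps(1) by (simp add: in_diff_count not_in_iff)
  then obtain N where "M - R = add_mset {#a, b#} N"
    by (metis insert_DiffM)
  then have "M = R + add_mset {#a, b#} N"
    using R(1) by (metis subset_mset.add_diff_inverse)
  then have "add_mset {#a, b#} R \<subseteq># M"
    by simp
  moreover have "\<Sum>\<^sub># (add_mset {#a, b#} R) = mset_set (insert a (insert b W))"
    using R(2) insert.hyps \<open>finite W\<close> by simp
  ultimately show ?case
    by blast
qed

text \<open>A perfect matching as red class gives red degree 1 everywhere.\<close>

lemma no_perfect_matching: "\<not> perfect_matching (\<lambda>x y. {#x, y#} \<in># M) V"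
proof
  assume "perfect_matching (\<lambda>x y. {#x, y#} \<in># M) V"
  then obtain R where "R \<subseteq># M" "\<Sum>\<^sub># R = mset_set V"
    using perfect_matching_subset finite_V by blast
  then have "colourable {4, 1} V M"
    using finite_V by (auto simp: colourable_def)
  then show False
    using not_colourable by blast
qed

text \<open>At most one member gives \<open>e\<close> a positive weight. An edge leaving that member
  ends in \<open>S\<close>, since members are closed outside \<open>S\<close>, and its weight 1 is
  paid for by this end; a loop has weight 2.\<close>

lemma weight_sum_le:
  assumes fam: "odd_family (\<lambda>x y. {#x, y#} \<in># M) V S \<C>" and e: "e \<in># M"
  shows "(\<Sum>C\<in>\<C>. weight C e) \<le> (\<Sum>s\<in>S. count e s) + (if \<exists>v. e = {#v, v#} then 2 else 0)"
proof (cases "\<exists>C\<in>\<C>. weight C e \<noteq> 0")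
  case False
  then have "(\<Sum>C\<in>\<C>. weight C e) = 0"
    by simp
  then show ?thesis
    by linarith
next
  case True
  then obtain C where C: "C \<in> \<C>" "weight C e \<noteq> 0"
    by blast
  note fin = odd_family_finite[OF fam finite_V]
  have sub: "B \<subseteq> V - S" "\<And>x y. x \<in> B \<Longrightarrow> y \<in> V \<Longrightarrow> {#x, y#} \<in># M \<Longrightarrow> y \<in> B \<union> S"
    if "B \<in> \<C>" for B
    using fam that by (auto simp: odd_family_def)
  have disj: "B \<inter> C = {}" if "B \<in> \<C>" "B \<noteq> C" for B
    using fam that C(1) by (auto simp: odd_family_def pairwise_def disjnt_def)
  from C(2) have "(\<exists>x\<in>C. \<exists>y\<in>V - C. e = {#x, y#}) \<or> (\<exists>x\<in>C. e = {#x, x#})"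
    by (auto simp: weight_def split: if_splits)
  then consider (1) x y where "x \<in> C" "y \<in> V - C" "e = {#x, y#}" | (2) x where "x \<in> C" "e = {#x, x#}"
    by blast
  then show ?thesis
  proof cases
    case (1 x y)
    then have "y \<in> S"
      using sub(2)[OF C(1)] e by blast
    have "weight B e = 0" if "B \<in> \<C> - {C}" for B
    proof -
      have "x \<notin> B" "y \<notin> B"
        using disj[of B] sub(1)[of B] that 1 \<open>y \<in> S\<close> by auto
      then show ?thesis
        using 1 by (auto simp: weight_def add_eq_conv_ex)
    qed
    moreover have "weight C e = 1"
      unfolding weight_def using 1 by (subst if_P) blast+
    ultimately have "(\<Sum>B\<in>\<C>. weight B e) = 1"
      using sum.remove[OF fin(1) C(1), of "\<lambda>B. weight B e"] by simp
    moreover have "1 \<le> count e y"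
      using 1 by simp
    moreover have "count e y \<le> (\<Sum>s\<in>S. count e s)"
      using \<open>y \<in> S\<close> fin(2) by (intro member_le_sum) simp_all
    ultimately show ?thesis
      by linarith
  next
    case (2 x)
    have "weight B e = 0" if "B \<in> \<C> - {C}" for B
    proof -
      have "x \<notin> B"
        using disj[of B] that 2 by auto
      then show ?thesis
        using 2 by (auto simp: weight_def add_eq_conv_ex)
    qed
    moreover have "weight C e \<le> 2"
      by (simp add: weight_def)
    ultimately have "(\<Sum>B\<in>\<C>. weight B e) \<le> 2"
      using sum.remove[OF fin(1) C(1), of "\<lambda>B. weight B e"] by simp
    moreover have "\<exists>v. e = {#v, v#}"
      using 2(2) by blast
    ultimately show ?thesis
      by (simp only: if_True trans_le_add2)
  qed
qed

lemma five_loops: "5 \<le> size (filter_mset (\<lambda>e. \<exists>v. e = {#v, v#}) M)"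
proof -
  let ?adj = "\<lambda>x y. {#x, y#} \<in># M"
  have sym: "symp ?adj"
    by (auto intro!: sympI simp: add_mset_commute)
  obtain S \<C> where fam: "odd_family ?adj V S \<C>" "card S < card \<C>"
    using perfect_matching_if_odd_families[OF finite_V sym] no_perfect_matching not_less by blast
  \<comment> \<open>\<open>card V\<close> is even, so an excess of one can be raised to two.\<close>
  have "\<exists>\<D>. odd_family ?adj V S \<D> \<and> card S + 2 \<le> card \<D>"
  proof (cases "card \<C> = Suc (card S)")
    case True
    then have "odd (card (V - S - \<Union>\<C>))"
      using odd_family_parity[OF fam(1) finite_V] even_card_V by simp
    then show ?thesis
      using odd_family_insert_rest[OF fam(1) finite_V sym] True by (metis add_2_eq_Suc' order_refl)
  next
    case False
    then show ?thesis
      using fam by (intro exI[of _ \<C>]) simp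
  qed
  then obtain \<D> where famD: "odd_family ?adj V S \<D>" and card_D: "card S + 2 \<le> card \<D>"
    by blast
  note fin = odd_family_finite[OF famD finite_V]
  have "5 \<le> (\<Sum>e\<in>#M. weight C e)" if C: "C \<in> \<D>" for C
  proof (rule sum_weight_ge)
    show sub: "C \<subseteq> V" and odd: "odd (card C)"
      using famD C by (auto simp: odd_family_def)
    \<comment> \<open>Two vertices outside \<open>C\<close>: the outer end of a crossing edge, which
      lies in \<open>S\<close>, and a vertex of another member.\<close>
    obtain x y where "x \<in> C" "y \<in> V - C" "{#x, y#} \<in># M"
      using sub odd by (rule crossing_edge)
    then have y: "y \<in> S"
      using famD C by (auto simp: odd_family_def)
    have "\<D> - {C} \<noteq> {}"
    proof
      assume "\<D> - {C} = {}"
      then have "card \<D> \<le> 1"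
        by (metis C card.empty card.insert_remove card_1_singleton_iff finite.emptyI insert_Diff le_refl One_nat_def)
      then show False
        using card_D by simp
    qed
    then obtain B where B: "B \<in> \<D>" "B \<noteq> C"
      by blast
    then have "odd (card B)" "B \<subseteq> V - S" "B \<inter> C = {}"
      using famD C by (auto simp: odd_family_def pairwise_def disjnt_def)
    moreover from this(1) obtain z where "z \<in> B"
      by (metis all_not_in_conv card.empty even_zero)
    ultimately have "{y, z} \<subseteq> V - C" "y \<noteq> z"
      using y \<open>y \<in> V - C\<close> by auto
    then show "2 \<le> card (V - C)"
      using card_mono[of "V - C" "{y, z}"] finite_V by simp
  qed
  \<comment> \<open>Double counting gives \<open>5 * (card S + 2) \<le> 5 * card S + 2 * n\<close>,
    where \<open>n\<close> is the number of loops.\<close>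
  then have "5 * card \<D> \<le> (\<Sum>C\<in>\<D>. \<Sum>e\<in>#M. weight C e)"
    using sum_bounded_below[of \<D> 5 "\<lambda>C. \<Sum>e\<in>#M. weight C e"] by (simp add: mult.commute)
  also have "\<dots> = (\<Sum>e\<in>#M. \<Sum>C\<in>\<D>. weight C e)"
    by (rule sum_swap_mset)
  also have "\<dots> \<le> (\<Sum>e\<in>#M. (\<Sum>s\<in>S. count e s) + (if \<exists>v. e = {#v, v#} then 2 else 0))"
    by (intro sum_mset_mono weight_sum_le[OF famD])
  also have "\<dots> = (\<Sum>s\<in>S. \<Sum>e\<in>#M. count e s) + (\<Sum>e\<in>#M. if \<exists>v. e = {#v, v#} then 2 else 0)"
    by (simp add: sum_mset.distrib sum_swap_mset)
  also have "(\<Sum>s\<in>S. \<Sum>e\<in>#M. count e s) = 5 * card S"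
  proof -
    have "(\<Sum>e\<in>#M. count e s) = 5" if "s \<in> S" for s
    proof -
      have "(\<Sum>e\<in>#A. count e s) = count (\<Sum>\<^sub># A) s" for A :: "'v multiset multiset"
        by (induction A) auto
      moreover have "s \<in> V"
        using famD that by (auto simp: odd_family_def)
      ultimately show ?thesis
        using sum_M finite_V by simp
    qed
    then show ?thesis
      by simp
  qed
  also have "(\<Sum>e\<in>#M. if \<exists>v. e = {#v, v#} then 2 else 0) = 2 * size (filter_mset (\<lambda>e. \<exists>v. e = {#v, v#}) M)"
    by (induction M) auto
  finally show ?thesis
    using card_D by linarith
qed

end

section \<open>Return from edge multisets to graphs\<close>

lemma loops_eq_size:
  assumes "finite (edges G)"
  shows "card (loops G) = size (filter_mset (\<lambda>e. \<exists>v. e = {#v, v#}) (edge_mset G))"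
  using assms by (simp add: loops_def edge_mset_def filter_mset_image_mset)

lemma edges_imp_edge_mset:
  assumes "finite (edges G)" "e \<in> edges G" "ends G e = A"
  shows "A \<in># edge_mset G"
  using assms by (auto simp: edge_mset_def)

theorem theorem8:
  fixes G :: "('v, 'e) pgraph"
  assumes "minimal_without_factor 5 {4, 1} G"
  shows "\<not> contains_complete 4 G \<and>
    \<not> (\<exists>e\<in>edges G. \<exists>f\<in>edges G. e \<noteq> f \<and> e \<notin> loops G \<and> ends G e = ends G f) \<and>
    \<not> (\<exists>u\<in>verts G. \<exists>v\<in>verts G. u \<noteq> v \<and> has_loop G u \<and> has_loop G v \<and> adjacent G u v) \<and>
    card (loops G) \<ge> 5 \<and>
    \<not> (\<exists>u1\<in>verts G. \<exists>u2\<in>verts G. \<exists>u3\<in>verts G.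
         \<exists>v1\<in>verts G. \<exists>v2\<in>verts G. \<exists>v3\<in>verts G.
           distinct [u1, u2, u3, v1, v2, v3] \<and>
           (\<forall>u\<in>{u1, u2, u3}. has_loop G u \<and> (\<forall>v\<in>{v1, v2, v3}. adjacent G u v)))"
proof -
  interpret minimal_multigraph "verts G" "edge_mset G"
    using assms by (rule minimal_multigraphI)
  have G: "pseudograph G"
    using assms by (simp add: minimal_without_factor_def)
  then have fin: "finite (edges G)"
    by (simp add: pseudograph_def)
  have adj: "{#u, v#} \<in># edge_mset G" if "adjacent G u v" for u v
    using that edges_imp_edge_mset[OF fin] by (auto simp: adjacent_def)
  have loop: "{#v, v#} \<in># edge_mset G" if "has_loop G v" for v
    using that edges_imp_edge_mset[OF fin] by (auto simp: has_loop_def)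
  show ?thesis
  proof (intro conjI)
    show "\<not> contains_complete 4 G"
    proof
      assume "contains_complete 4 G"
      then obtain K where K: "subgraph K G" "complete_graph 4 K"
        by (auto simp: contains_complete_def)
      then have "card (verts K) = 4"
        by (simp add: complete_graph_def)
      then obtain a b c d where abcd: "verts K = {a, b, c, d}" "distinct [a, b, c, d]"
        by (auto simp: numeral_eq_Suc card_Suc_eq)
      have "{#u, v#} \<in># edge_mset G" if uv: "u \<in> verts K" "v \<in> verts K" "u \<noteq> v" for u v
      proof -
        obtain e where "e \<in> edges K" "ends K e = {#u, v#}"
          using K(2) uv unfolding complete_graph_def by blast
        then have "adjacent G u v"
          using K(1) by (auto simp: subgraph_def adjacent_def)
        then show ?thesis
          by (rule adj)
      qed
      then show False
        using no_K4[OF abcd(2)] abcd by auto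
    qed
    show "\<not> (\<exists>e\<in>edges G. \<exists>f\<in>edges G. e \<noteq> f \<and> e \<notin> loops G \<and> ends G e = ends G f)"
    proof
      assume "\<exists>e\<in>edges G. \<exists>f\<in>edges G. e \<noteq> f \<and> e \<notin> loops G \<and> ends G e = ends G f"
      then obtain e f where ef: "e \<in> edges G" "f \<in> edges G" "e \<noteq> f" "e \<notin> loops G"
        "ends G f = ends G e"
        by metis
      have "size (ends G e) = 2"
        using G ef(1) by (simp add: pseudograph_def)
      moreover from this obtain u where "u \<in># ends G e"
        by (metis size_eq_Suc_imp_elem numeral_2_eq_2)
      ultimately obtain v where uv: "ends G e = {#u, v#}"
        by (rule pair_mset)
      then have "u \<noteq> v"
        using ef(1,4) by (auto simp: loops_def)
      \<comment> \<open>Distinct edges with the same ends become one pair of multiplicity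
        two.\<close>
      have "mset_set {e, f} \<subseteq># mset_set (edges G)"
        using ef(1,2) fin by (intro subset_imp_msubset_mset_set) auto
      from image_mset_subseteq_mono[OF this, of "ends G"]
      have "{#{#u, v#}, {#u, v#}#} \<subseteq># edge_mset G"
        using ef(3,5) by (simp add: edge_mset_def uv)
      then show False
        using no_parallel[OF \<open>u \<noteq> v\<close>] by blast
    qed
    show "\<not> (\<exists>u\<in>verts G. \<exists>v\<in>verts G. u \<noteq> v \<and> has_loop G u \<and> has_loop G v \<and> adjacent G u v)"
      using no_adjacent_loops adj loop by blast
    show "card (loops G) \<ge> 5"
      using five_loops loops_eq_size[OF fin] by simp
    show "\<not> (\<exists>u1\<in>verts G. \<exists>u2\<in>verts G. \<exists>u3\<in>verts G.
         \<exists>v1\<in>verts G. \<exists>v2\<in>verts G. \<exists>v3\<in>verts G.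
           distinct [u1, u2, u3, v1, v2, v3] \<and>
           (\<forall>u\<in>{u1, u2, u3}. has_loop G u \<and> (\<forall>v\<in>{v1, v2, v3}. adjacent G u v)))"
    proof
      assume "\<exists>u1\<in>verts G. \<exists>u2\<in>verts G. \<exists>u3\<in>verts G.
         \<exists>v1\<in>verts G. \<exists>v2\<in>verts G. \<exists>v3\<in>verts G.
           distinct [u1, u2, u3, v1, v2, v3] \<and>
           (\<forall>u\<in>{u1, u2, u3}. has_loop G u \<and> (\<forall>v\<in>{v1, v2, v3}. adjacent G u v))"
      then obtain u1 u2 u3 v1 v2 v3 where dist: "distinct [u1, u2, u3, v1, v2, v3]"
        and uv: "\<forall>u\<in>{u1, u2, u3}. has_loop G u \<and> (\<forall>v\<in>{v1, v2, v3}. adjacent G u v)"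
        by blast
      show False
        using no_looped_K33[OF dist] uv adj loop by simp
    qed
  qed
qed

end
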